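(* Let $\Bbbk$ be a field with $\operatorname{char}\Bbbk\ne2$, $R=\Bbbk[u_1,\ldots,u_m]$, $\alpha=(\alpha_{ij})\in M_{m\times 2}(\Bbbk)$, and let $\mathcal{O}\in\operatorname{Irr}(R)/\mathbb{Z}^2$ be an orbit. Consider for $p=(p_1,p_2)\in R^2$ the equation $$p_1(u-\tfrac{\alpha_2}{2})\,p_2(u-\tfrac{\alpha_1}{2})=p_1(u+\tfrac{\alpha_2}{2})\,p_2(u+\tfrac{\alpha_1}{2}),\qquad( * )$$ where $u=(u_1,\ldots,u_m)$ and $\alpha_i=(\alpha_{1i},\ldots,\alpha_{mi})$. (a) Given any finite higher spin $6$-vertex configuration $\mathcal{L}=(\mathcal{L}_1,\mathcal{L}_2)$ in $\mathcal{O}$, define $p_1,p_2\in R$ by $$p_i=\prod_{e\in E_i}e^{\mathcal{L}_i(e)}\qquad\forall i\in\{1,2\}.\qquad( ** )$$ Then $p=(p_1,p_2)$ is a monic $\mathcal{O}$-orbital solution to $( * )$. (b) Conversely, given any monic $\mathcal{O}$-orbital solution $p=(p_1,p_2)$ to $( * )$, there exists a unique finite higher spin $6$-vertex configuration $\mathcal{L}$ in $\mathcal{O}$ such that $( ** )$ holds.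
   Context: Fix a monomial order on $R$ (e.g. lexicographic); a nonzero polynomial is monic if its leading monomial has coefficient $1$, and a tuple is monic if each entry is nonzero and monic. $\operatorname{Irr}(R)$ is the set of monic irreducible polynomials in $R$. For $i=1,2$, $\sigma_i$ is the $\Bbbk$-algebra automorphism of $R$ with $\sigma_i(u_j)=u_j-\alpha_{ji}$, and $\sigma_i^{\pm1/2}(u_j)=u_j\mp\frac12\alpha_{ji}$. The group $\mathbb{Z}^2$ acts on $\operatorname{Irr}(R)$ by $(k,l).q=\sigma_1^k\sigma_2^l(q)$. For an orbit $\mathcal{O}$, put $E_i=\sigma_i^{1/2}(\mathcal{O})$ ($i=1,2$) and $V_{12}=\sigma_1^{1/2}\sigma_2^{1/2}(\mathcal{O})$. A monic $p=(p_1,p_2)$ is $\mathcal{O}$-orbital if, for each $i$, every (monic) irreducible factor of $p_i$ belongs to $E_i$. A higher spin $6$-vertex configuration in $\mathcal{O}$ is a pair $\mathcal{L}=(\mathcal{L}_1,\mathcal{L}_2)$ of functions $\mathcal{L}_i:E_i\to\mathbb{Z}_{\ge0}$ such that for every $v\in V_{12}$ $$\mathcal{L}_1(\sigma_2^{1/2}(v))+\mathcal{L}_2(\sigma_1^{1/2}(v))=\mathcal{L}_1(\sigma_2^{-1/2}(v))+\mathcal{L}_2(\sigma_1^{-1/2}(v)).$$ It is finite if $\#\{e\in E_i\mid\mathcal{L}_i(e)\neq0\}<\infty$ for $i=1,2$. *)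

theory Defs
  imports "HOL-Analysis.Analysis" "HOL-Library.Poly_Mapping"
    "HOL-Computational_Algebra.Factorial_Ring"
begin

text \<open>
  The ring \<open>R = k[u\<^sub>1, ..., u\<^sub>m]\<close> is the monoid algebra of the commutative monoid of exponent
  vectors, with the variables indexed by a finite type \<open>'m\<close>. The index set
  \<open>{1,2}\<close> is the numeral type \<open>2\<close>; note that \<open>2 = 0\<close> in that type.
\<close>

type_synonym 'm monomial = "'m \<Rightarrow>\<^sub>0 nat"
type_synonym ('m, 'k) mpoly = "('m \<Rightarrow>\<^sub>0 nat) \<Rightarrow>\<^sub>0 'k"

definition Const :: "'k \<Rightarrow> ('m, 'k::zero) mpoly" where
  "Const c = Poly_Mapping.single 0 c"

definition Var :: "'m \<Rightarrow> ('m, 'k::zero_neq_one) mpoly" where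
  "Var j = Poly_Mapping.single (Poly_Mapping.single j 1) 1"

text \<open>The \<open>k\<close>-algebra endomorphism of \<open>R\<close> with \<open>u\<^sub>j \<mapsto> f j\<close>.\<close>

definition subst :: "('m \<Rightarrow> ('m, 'k) mpoly) \<Rightarrow> ('m::finite, 'k::comm_ring_1) mpoly \<Rightarrow> ('m, 'k) mpoly" where
  "subst f p = (\<Sum>a\<in>Poly_Mapping.keys p.
     Const (Poly_Mapping.lookup p a) * (\<Prod>j\<in>UNIV. f j ^ Poly_Mapping.lookup a j))"

text \<open>\<open>shift c p\<close> is \<open>p(u + c)\<close>.\<close>

definition shift :: "'k ^ 'm \<Rightarrow> ('m::finite, 'k::comm_ring_1) mpoly \<Rightarrow> ('m, 'k) mpoly" where
  "shift c = subst (\<lambda>j. Var j + Const (c $ j))"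


text \<open>
  A monomial order is represented by its relation \<open>\<le>\<close>. The condition \<open>0 \<le> a\<close> (i.e. the
  monomial \<open>1\<close> is least) is, for finitely many variables, equivalent to being a well-order.
\<close>

definition monomial_order :: "('m monomial \<times> 'm monomial) set \<Rightarrow> bool" where
  "monomial_order r \<longleftrightarrow>
     linear_order r \<and>
     (\<forall>a. (0, a) \<in> r) \<and>
     (\<forall>a b c. (a, b) \<in> r \<longrightarrow> (a + c, b + c) \<in> r)"

definition lead_monomial :: "('m monomial \<times> 'm monomial) set \<Rightarrow> ('m, 'k::zero) mpoly \<Rightarrow> 'm monomial" where
  "lead_monomial r p =
     (THE a. a \<in> Poly_Mapping.keys p \<and> (\<forall>b\<in>Poly_Mapping.keys p. (b, a) \<in> r))"

definition monic :: "('m monomial \<times> 'm monomial) set \<Rightarrow> ('m, 'k::zero_neq_one) mpoly \<Rightarrow> bool" where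
  "monic r p \<longleftrightarrow> p \<noteq> 0 \<and> Poly_Mapping.lookup p (lead_monomial r p) = 1"

definition Irr :: "('m monomial \<times> 'm monomial) set \<Rightarrow> ('m, 'k::field) mpoly set" where
  "Irr r = {q. monic r q \<and> irreducible q}"


definition sigma :: "'k ^ 2 ^ 'm \<Rightarrow> 2 \<Rightarrow> ('m::finite, 'k::field) mpoly \<Rightarrow> ('m, 'k) mpoly" where
  "sigma \<alpha> i = shift (- column i \<alpha>)"

definition sigma_half :: "'k ^ 2 ^ 'm \<Rightarrow> 2 \<Rightarrow> ('m::finite, 'k::field) mpoly \<Rightarrow> ('m, 'k) mpoly" where
  "sigma_half \<alpha> i = shift (- ((1/2) *s column i \<alpha>))"

definition sigma_neg_half :: "'k ^ 2 ^ 'm \<Rightarrow> 2 \<Rightarrow> ('m::finite, 'k::field) mpoly \<Rightarrow> ('m, 'k) mpoly" where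
  "sigma_neg_half \<alpha> i = shift ((1/2) *s column i \<alpha>)"

definition sigma_pow :: "'k ^ 2 ^ 'm \<Rightarrow> 2 \<Rightarrow> int \<Rightarrow> ('m::finite, 'k::field) mpoly \<Rightarrow> ('m, 'k) mpoly" where
  "sigma_pow \<alpha> i k =
     (if k \<ge> 0 then sigma \<alpha> i ^^ nat k else inv (sigma \<alpha> i) ^^ nat (- k))"

definition orbit :: "'k ^ 2 ^ 'm \<Rightarrow> ('m::finite, 'k::field) mpoly \<Rightarrow> ('m, 'k) mpoly set" where
  "orbit \<alpha> q = {sigma_pow \<alpha> 1 k (sigma_pow \<alpha> 2 l q) | k l. True}"

text \<open>The set of orbits \<open>Irr(R)/\<int>\<^sup>2\<close>.\<close>

definition Irr_orbits ::
    "('m monomial \<times> 'm monomial) set \<Rightarrow> 'k ^ 2 ^ 'm \<Rightarrow> ('m::finite, 'k::field) mpoly set set" where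
  "Irr_orbits r \<alpha> = orbit \<alpha> ` Irr r"


definition edges :: "'k ^ 2 ^ 'm \<Rightarrow> ('m::finite, 'k::field) mpoly set \<Rightarrow> 2 \<Rightarrow> ('m, 'k) mpoly set" where
  "edges \<alpha> \<O> i = sigma_half \<alpha> i ` \<O>"

definition vertices :: "'k ^ 2 ^ 'm \<Rightarrow> ('m::finite, 'k::field) mpoly set \<Rightarrow> ('m, 'k) mpoly set" where
  "vertices \<alpha> \<O> = (\<lambda>q. sigma_half \<alpha> 1 (sigma_half \<alpha> 2 q)) ` \<O>"

definition orbital ::
    "('m monomial \<times> 'm monomial) set \<Rightarrow> 'k ^ 2 ^ 'm \<Rightarrow> ('m::finite, 'k::field) mpoly set
      \<Rightarrow> ('m, 'k) mpoly ^ 2 \<Rightarrow> bool" where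
  "orbital r \<alpha> \<O> p \<longleftrightarrow> (\<forall>i. \<forall>q\<in>Irr r. q dvd p $ i \<longrightarrow> q \<in> edges \<alpha> \<O> i)"

text \<open>
  A function \<open>L\<^sub>i : E\<^sub>i \<rightarrow> \<nat>\<close> is a total function that is extensional on \<open>E\<^sub>i\<close> (equal to
  \<open>undefined\<close> elsewhere), so that equality of configurations is equality on the \<open>E\<^sub>i\<close>.
\<close>

definition six_vertex_config ::
    "'k ^ 2 ^ 'm \<Rightarrow> ('m::finite, 'k::field) mpoly set \<Rightarrow> (2 \<Rightarrow> ('m, 'k) mpoly \<Rightarrow> nat) \<Rightarrow> bool" where
  "six_vertex_config \<alpha> \<O> L \<longleftrightarrow>
     (\<forall>i. L i \<in> extensional (edges \<alpha> \<O> i)) \<and>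
     (\<forall>v\<in>vertices \<alpha> \<O>.
        L 1 (sigma_half \<alpha> 2 v) + L 2 (sigma_half \<alpha> 1 v) =
        L 1 (sigma_neg_half \<alpha> 2 v) + L 2 (sigma_neg_half \<alpha> 1 v))"

definition finite_config ::
    "'k ^ 2 ^ 'm \<Rightarrow> ('m::finite, 'k::field) mpoly set \<Rightarrow> (2 \<Rightarrow> ('m, 'k) mpoly \<Rightarrow> nat) \<Rightarrow> bool" where
  "finite_config \<alpha> \<O> L \<longleftrightarrow> (\<forall>i. finite {e \<in> edges \<alpha> \<O> i. L i e \<noteq> 0})"

text \<open>
  The product of the \<open>e ^ L\<^sub>i(e)\<close> over \<open>e \<in> E\<^sub>i\<close>. The set \<open>E\<^sub>i\<close> may be infinite, and a product
  over an infinite set is \<open>1\<close> by convention, so the trivial factors have to be left out.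
\<close>

definition config_poly ::
    "'k ^ 2 ^ 'm \<Rightarrow> ('m::finite, 'k::field) mpoly set \<Rightarrow> (2 \<Rightarrow> ('m, 'k) mpoly \<Rightarrow> nat)
      \<Rightarrow> 2 \<Rightarrow> ('m, 'k) mpoly" where
  "config_poly \<alpha> \<O> L i = (\<Prod>e\<in>{e \<in> edges \<alpha> \<O> i. L i e \<noteq> 0}. e ^ L i e)"

definition solution :: "'k ^ 2 ^ 'm \<Rightarrow> ('m::finite, 'k::field) mpoly ^ 2 \<Rightarrow> bool" where
  "solution \<alpha> p \<longleftrightarrow>
     shift (- ((1/2) *s column 2 \<alpha>)) (p $ 1) * shift (- ((1/2) *s column 1 \<alpha>)) (p $ 2) =
     shift ((1/2) *s column 2 \<alpha>) (p $ 1) * shift ((1/2) *s column 1 \<alpha>) (p $ 2)"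

end

(* The ring R is factorial, and translations permute its monic irreducible polynomials. A monic
   p_i is therefore the product of a unique multiset M_i of monic irreducibles, and p_i is
   orbital iff M_i lives on E_i. By unique factorization the equation for p says that
   sigma_2^(1/2) M_1 + sigma_1^(1/2) M_2 and sigma_2^(-1/2) M_1 + sigma_1^(-1/2) M_2 agree as
   multisets; comparing multiplicities at the vertices v in V_12 gives the six-vertex condition
   for the multiplicity functions. *)
theory Submission
  imports Defs "HOL-Computational_Algebra.Polynomial"
begin

subsection \<open>Evaluation of polynomials in algebras\<close>

text \<open>Most of the work is unique factorization itself. Existence is an induction on a size
  that drops for proper factors; uniqueness rests on irreducible polynomials being prime, which is
  proved by adjoining one variable at a time. All polynomials stay in the one type
  \<open>mpoly\<close>, and the ring in fewer variables appears only as a bound on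
  \<open>vars\<close>. Monic representatives remove the units: associates in \<open>Irr r\<close>
  are equal, so a factorization is a multiset with nothing left to normalize. Translations respect
  this choice because 1 is the least monomial, so that u_j + c still has leading term u_j. The
  multiset equation concerns every polynomial, the six-vertex condition only those in V_12. They
  agree because an edge of E_1 or E_2, moved by the half steps that occur, always lands in V_12. For
  this, two half steps have to make a full step, which is where characteristic different from 2
  enters.\<close>

locale ring_morphism =
  fixes h :: "'a::comm_ring_1 \<Rightarrow> 'b::comm_ring_1"
  assumes hom_one [simp]: "h 1 = 1"
    and hom_add [simp]: "h (a + b) = h a + h b"
    and hom_mult [simp]: "h (a * b) = h a * h b"
begin

lemma hom_zero [simp]: "h 0 = 0"
  using hom_add[of 0 0] by simp

lemma hom_minus [simp]: "h (a - b) = h a - h b"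
  using hom_add[of "a - b" b] by (simp add: algebra_simps)

lemma hom_sum: "h (sum f X) = (\<Sum>x\<in>X. h (f x))"
  by (induction X rule: infinite_finite_induct) auto

lemma hom_prod: "h (prod f X) = (\<Prod>x\<in>X. h (f x))"
  by (induction X rule: infinite_finite_induct) auto

lemma hom_power: "h (a ^ n) = h a ^ n"
  by (induction n) auto

lemma hom_prod_mset: "h (prod_mset M) = prod_mset (image_mset h M)"
  by (induction M) auto

lemma hom_dvd: "a dvd b \<Longrightarrow> h a dvd h b"
  by (auto simp: dvd_def)

end

lemma ring_morphism_Const: "ring_morphism (Const :: 'k::comm_ring_1 \<Rightarrow> ('m, 'k) mpoly)"
  by standard (auto simp: Const_def single_add mult_single)

interpretation Const: ring_morphism "Const :: 'k::comm_ring_1 \<Rightarrow> ('m, 'k) mpoly"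
  by (rule ring_morphism_Const)

lemma keys_Const: "Poly_Mapping.keys (Const c) \<subseteq> {0}"
  by (simp add: Const_def)

lemma Const_eq_0_iff [simp]: "Const c = 0 \<longleftrightarrow> c = 0"
  by (metis Const_def lookup_single_eq single_zero)

lemma Const_dvd_1: "c \<noteq> 0 \<Longrightarrow> (Const c :: ('m, 'k::field) mpoly) dvd 1"
  by (metis Const.hom_mult Const.hom_one dvd_triv_left right_inverse)

lemma mpoly_eq_sum_single:
  "p = (\<Sum>a\<in>Poly_Mapping.keys p. Poly_Mapping.single a (Poly_Mapping.lookup p a))"
  by (rule poly_mapping_eqI) (auto simp: lookup_sum lookup_single when_def in_keys_iff)

lemma mpoly_induct [case_names zero add]:
  fixes p :: "'a \<Rightarrow>\<^sub>0 'b::comm_monoid_add"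
  assumes "P 0" and "\<And>a c q. P q \<Longrightarrow> P (Poly_Mapping.single a c + q)"
  shows "P p"
proof -
  have "P (\<Sum>a\<in>A. Poly_Mapping.single a (Poly_Mapping.lookup p a))" if "finite A" for A
    using that by (induction A) (auto intro: assms)
  then show ?thesis
    by (metis finite_keys mpoly_eq_sum_single)
qed

text \<open>The formula of \<open>subst\<close>, with the coefficient map and the target ring left
  free. The targets that occur are R itself, for \<open>subst\<close> and \<open>shift\<close>, and
  R[x], for \<open>main_poly\<close>.\<close>

definition evaluate :: "('k \<Rightarrow> 'b) \<Rightarrow> ('m \<Rightarrow> 'b) \<Rightarrow> ('m::finite, 'k::comm_ring_1) mpoly \<Rightarrow> 'b::comm_ring_1"
  where "evaluate h f p = (\<Sum>a\<in>Poly_Mapping.keys p.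
    h (Poly_Mapping.lookup p a) * (\<Prod>j\<in>UNIV. f j ^ Poly_Mapping.lookup a j))"

lemma subst_eq_evaluate: "subst f = evaluate Const f"
  by (simp add: fun_eq_iff subst_def evaluate_def)

lemma evaluate_cong:
  assumes "\<And>a j. a \<in> Poly_Mapping.keys p \<Longrightarrow> Poly_Mapping.lookup a j \<noteq> 0 \<Longrightarrow> f j = g j"
  shows "evaluate h f p = evaluate h g p"
  unfolding evaluate_def
  by (intro sum.cong refl arg_cong2[where f = "(*)"] prod.cong) (metis assms power_0)

context ring_morphism
begin

text \<open>Since \<open>h 0 = 0\<close>, keys may be added freely; this lets \<open>p\<close>,
  \<open>q\<close> and \<open>p + q\<close> be summed over one common set even when terms
  cancel.\<close>

lemma evaluate_superset:
  assumes "finite A" "Poly_Mapping.keys p \<subseteq> A"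
  shows "evaluate h f p = (\<Sum>a\<in>A. h (Poly_Mapping.lookup p a) * (\<Prod>j\<in>UNIV. f j ^ Poly_Mapping.lookup a j))"
  unfolding evaluate_def by (rule sum.mono_neutral_left) (use assms in \<open>auto simp: in_keys_iff\<close>)

lemma evaluate_single:
  "evaluate h f (Poly_Mapping.single a c) = h c * (\<Prod>j\<in>UNIV. f j ^ Poly_Mapping.lookup a j)"
  by (subst evaluate_superset[where A = "{a}"]) auto

lemma evaluate_add: "evaluate h f (p + q) = evaluate h f p + evaluate h f q"
proof -
  let ?A = "Poly_Mapping.keys p \<union> Poly_Mapping.keys q"
  have "Poly_Mapping.keys (p + q) \<subseteq> ?A"
    by (rule keys_add)
  then show ?thesis
    by (simp add: evaluate_superset[where A = ?A] lookup_add sum.distrib distrib_right)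
qed

lemma evaluate_mult: "evaluate h f (p * q) = evaluate h f p * evaluate h f q"
proof (induction p rule: mpoly_induct)
  case zero
  show ?case by (simp add: evaluate_def)
next
  case (add a c p)
  have "evaluate h f (Poly_Mapping.single a c * q) = evaluate h f (Poly_Mapping.single a c) * evaluate h f q"
  proof (induction q rule: mpoly_induct)
    case zero
    show ?case by (simp add: evaluate_def)
  next
    case (add b d q)
    then show ?case
      by (simp add: distrib_left evaluate_add evaluate_single mult_single lookup_add power_add prod.distrib mult_ac)
  qed
  with add show ?case
    by (simp add: distrib_right evaluate_add)
qed

lemma evaluate_one: "evaluate h f 1 = 1"
  using evaluate_single[of f 0 1] by simp

lemma ring_morphism_evaluate: "ring_morphism (evaluate h f)"
  by standard (simp_all add: evaluate_one evaluate_add evaluate_mult)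

lemma evaluate_Const: "evaluate h f (Const c) = h c"
  by (simp add: Const_def evaluate_single)

lemma evaluate_Var: "evaluate h f (Var j) = f j"
proof -
  have "(\<Prod>i\<in>UNIV. f i ^ Poly_Mapping.lookup (Poly_Mapping.single j 1) i) = (\<Prod>i\<in>UNIV. if i = j then f i else 1)"
    by (intro prod.cong) (auto simp: lookup_single)
  then show ?thesis
    by (simp add: Var_def evaluate_single)
qed

end

lemma evaluate_comp:
  assumes "ring_morphism g"
  shows "g (evaluate h f p) = evaluate (\<lambda>c. g (h c)) (\<lambda>j. g (f j)) p"
proof -
  interpret ring_morphism g by fact
  show ?thesis
    by (simp add: evaluate_def hom_sum hom_prod hom_power)
qed

lemma monomial_eq_sum_single: "(\<Sum>j\<in>UNIV. Poly_Mapping.single j (Poly_Mapping.lookup a j)) = (a :: 'm::finite monomial)"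
  by (rule poly_mapping_eqI) (auto simp: lookup_sum lookup_single when_def)

lemma prod_Var_power: "(\<Prod>j\<in>UNIV. Var j ^ Poly_Mapping.lookup a j) = (Poly_Mapping.single a 1 :: ('m::finite, 'k::comm_ring_1) mpoly)"
proof -
  have power: "Var j ^ n = (Poly_Mapping.single (Poly_Mapping.single j n) 1 :: ('m, 'k) mpoly)" for j n
    by (induction n) (auto simp: Var_def mult_single simp flip: single_add)
  have prod: "(\<Prod>j\<in>J. Poly_Mapping.single (g j) 1) = (Poly_Mapping.single (sum g J) 1 :: ('m, 'k) mpoly)"
    if "finite J" for J and g :: "'m \<Rightarrow> 'm monomial"
    using that by (induction J) (auto simp: mult_single)
  show ?thesis
    by (simp add: power prod monomial_eq_sum_single)
qed

lemma evaluate_Const_Var: "evaluate Const Var p = p"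
proof -
  have "evaluate Const Var p = (\<Sum>a\<in>Poly_Mapping.keys p. Poly_Mapping.single a (Poly_Mapping.lookup p a))"
    unfolding evaluate_def prod_Var_power by (simp add: Const_def mult_single)
  then show ?thesis
    by (simp flip: mpoly_eq_sum_single)
qed


subsection \<open>One variable singled out\<close>

definition vars :: "('m, 'k::zero) mpoly \<Rightarrow> 'm set" where
  "vars p = {j. \<exists>a\<in>Poly_Mapping.keys p. Poly_Mapping.lookup a j \<noteq> 0}"

lemma vars_0 [simp]: "vars 0 = {}"
  and vars_1 [simp]: "vars 1 = {}"
  and vars_Const [simp]: "vars (Const c) = {}"
  and vars_Var: "vars (Var j) \<subseteq> {j}"
  using keys_Const[of c] by (auto simp: vars_def Var_def lookup_single when_def split: if_splits)

lemma vars_add: "vars (p + q) \<subseteq> vars p \<union> vars q"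
  using keys_add[of p q] by (force simp: vars_def)

lemma vars_uminus: "vars (- p) = vars (p :: ('m, 'k::ab_group_add) mpoly)"
  by (simp add: vars_def in_keys_iff)

lemma vars_diff: "vars (p - q) \<subseteq> vars p \<union> vars (q :: ('m, 'k::ab_group_add) mpoly)"
  using vars_add[of p "- q"] by (simp add: vars_uminus)

lemma vars_mult: "vars (p * q) \<subseteq> vars p \<union> vars (q :: ('m, 'k::comm_ring_1) mpoly)"
  using keys_mult[of p q] by (force simp: vars_def lookup_add)

lemma vars_sum: "vars (sum f A) \<subseteq> (\<Union>x\<in>A. vars (f x))"
proof (induction A rule: infinite_finite_induct)
  case (insert x A)
  then show ?case
    using vars_add[of "f x" "sum f A"] by auto
qed simp_all

lemma vars_empty_imp_Const:
  assumes "vars p = {}"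
  shows "p \<in> range Const"
proof (rule range_eqI, rule poly_mapping_eqI)
  fix a
  have "a = 0" if "a \<in> Poly_Mapping.keys p"
    using assms that by (intro poly_mapping_eqI) (auto simp: vars_def)
  then show "Poly_Mapping.lookup p a = Poly_Mapping.lookup (Const (Poly_Mapping.lookup p 0)) a"
    by (cases "a = 0") (auto simp: Const_def lookup_single in_keys_iff)
qed

text \<open>R viewed as a polynomial ring in \<open>x\<close>. The coefficients keep the type of R
  and merely avoid \<open>x\<close>, so a descent to fewer variables changes no types.\<close>

definition main_poly :: "'m \<Rightarrow> ('m::finite, 'k::comm_ring_1) mpoly \<Rightarrow> ('m, 'k) mpoly poly" where
  "main_poly x = evaluate (\<lambda>c. [:Const c:]) (\<lambda>j. if j = x then [:0, 1:] else [:Var j:])"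

lemma ring_morphism_pCons: "ring_morphism (\<lambda>a. [:a:])"
  by standard auto

lemma ring_morphism_poly: "ring_morphism (\<lambda>p. poly p a)"
  by standard auto

lemma ring_morphism_pCons_Const: "ring_morphism (\<lambda>c. [:Const c:])"
  by standard auto

interpretation main_poly: ring_morphism "main_poly x :: ('m::finite, 'k::comm_ring_1) mpoly \<Rightarrow> _"
  unfolding main_poly_def
  by (rule ring_morphism.ring_morphism_evaluate[OF ring_morphism_pCons_Const])

declare main_poly.hom_mult [simp del]

lemma main_poly_Var: "main_poly x (Var x) = [:0, 1:]"
  by (simp add: main_poly_def ring_morphism.evaluate_Var[OF ring_morphism_pCons_Const])

text \<open>Substituting \<open>x\<close> back undoes \<open>main_poly\<close>, which is therefore
  injective: zero and independence of \<open>x\<close> can be tested on its coefficients.\<close>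

lemma poly_main_poly: "poly (main_poly x p) (Var x) = p"
proof -
  have "poly (main_poly x p) (Var x) = evaluate Const Var p"
    unfolding main_poly_def evaluate_comp[OF ring_morphism_poly]
    by (rule arg_cong2[where f = "\<lambda>h f. evaluate h f p"]) (auto simp: fun_eq_iff)
  then show ?thesis
    by (simp add: evaluate_Const_Var)
qed

lemma main_poly_eq_0_iff [simp]: "main_poly x p = 0 \<longleftrightarrow> p = 0"
  by (metis main_poly.hom_zero poly_0 poly_main_poly)

lemma main_poly_free: "x \<notin> vars p \<Longrightarrow> main_poly x p = [:p:]"
proof -
  assume "x \<notin> vars p"
  then have "main_poly x p = evaluate (\<lambda>c. [:Const c:]) (\<lambda>j. [:Var j:]) p"
    unfolding main_poly_def by (intro evaluate_cong) (auto simp: vars_def)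
  also have "\<dots> = [:evaluate Const Var p:]"
    by (simp add: evaluate_comp[OF ring_morphism_pCons])
  finally show ?thesis
    by (simp add: evaluate_Const_Var)
qed

lemma vars_coeff_mult:
  assumes "\<And>i. vars (coeff p i) \<subseteq> S" "\<And>i. vars (coeff q i) \<subseteq> S"
  shows "vars (coeff (p * q) i :: ('m, 'k::comm_ring_1) mpoly) \<subseteq> S"
proof -
  have "vars (coeff p j * coeff q (i - j)) \<subseteq> S" for j
    using assms vars_mult by (meson Un_least order_trans)
  then show ?thesis
    unfolding coeff_mult by (intro order_trans[OF vars_sum] UN_least)
qed

lemma vars_coeff_power:
  assumes "\<And>i. vars (coeff p i) \<subseteq> S"
  shows "vars (coeff (p ^ n) i :: ('m, 'k::comm_ring_1) mpoly) \<subseteq> S"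
proof (induction n arbitrary: i)
  case 0
  show ?case by (cases i) simp_all
next
  case (Suc n)
  then show ?case
    by (simp add: vars_coeff_mult assms)
qed

lemma vars_coeff_prod:
  assumes "\<And>x i. x \<in> A \<Longrightarrow> vars (coeff (f x) i) \<subseteq> S"
  shows "vars (coeff (prod f A) i :: ('m, 'k::comm_ring_1) mpoly) \<subseteq> S"
  using assms
proof (induction A arbitrary: i rule: infinite_finite_induct)
  case (infinite A)
  then show ?case by (cases i) simp_all
next
  case empty
  then show ?case by (cases i) simp_all
next
  case (insert x A)
  then show ?case
    by (simp add: vars_coeff_mult)
qed

text \<open>The powers of the factor for \<open>x\<close> contribute only the coefficients 0 and 1,
  every other factor only variables of \<open>p\<close>. This is what makes induction on a set of
  variables go through.\<close>

lemma vars_coeff_main_poly: "vars (coeff (main_poly x p) i) \<subseteq> vars p - {x}"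
proof -
  define f :: "'a \<Rightarrow> ('a, 'b) mpoly poly" where "f j = (if j = x then [:0, 1:] else [:Var j:])" for j
  have "vars (coeff (f j ^ Poly_Mapping.lookup a j) i) \<subseteq> vars p - {x}"
    if "a \<in> Poly_Mapping.keys p" for a i j
  proof (cases "Poly_Mapping.lookup a j = 0")
    case True
    then show ?thesis by (cases i) simp_all
  next
    case False
    then have "vars (coeff (f j) i) \<subseteq> vars p - {x}" for i
      using that vars_Var[of j] by (auto simp: vars_def f_def coeff_pCons split: nat.splits)
    then show ?thesis
      by (rule vars_coeff_power)
  qed
  then have "vars (coeff ([:Const c:] * (\<Prod>j\<in>UNIV. f j ^ Poly_Mapping.lookup a j)) i) \<subseteq> vars p - {x}"
    if "a \<in> Poly_Mapping.keys p" for a c i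
    using that by (intro vars_coeff_mult vars_coeff_prod) (auto simp: coeff_pCons split: nat.splits)
  then show ?thesis
    unfolding main_poly_def evaluate_def coeff_sum f_def
    by (intro order_trans[OF vars_sum] UN_least)
qed

text \<open>Induction on the variables involved: the product of the leading coefficients in
  \<open>x\<close> is the coefficient of the product at the sum of the degrees, and both factors
  have lost \<open>x\<close>. \<open>coeff_mult_degree_sum\<close> is valid even while zero divisors
  among the coefficients are not excluded.\<close>

lemma mpoly_no_zero_divisors:
  fixes p q :: "('m::finite, 'k::idom) mpoly"
  assumes "p * q = 0"
  shows "p = 0 \<or> q = 0"
proof -
  have "p = 0 \<or> q = 0" if "finite S" "vars p \<subseteq> S" "vars q \<subseteq> S" "p * q = 0"
    for S and p q :: "('m, 'k) mpoly"
    using that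
  proof (induction S arbitrary: p q)
    case empty
    then have "vars p = {}" "vars q = {}"
      by simp_all
    then obtain a b where "p = Const a" "q = Const b"
      using vars_empty_imp_Const by (metis rangeE)
    then have "Const (a * b) = (0 :: ('m, 'k) mpoly)"
      using empty.prems(3) by (simp only: Const.hom_mult)
    then have "a * b = 0"
      by (simp only: Const_eq_0_iff)
    with \<open>p = Const a\<close> \<open>q = Const b\<close> show ?case
      by simp
  next
    case (insert x S)
    let ?p = "main_poly x p" and ?q = "main_poly x q"
    have "lead_coeff ?p * lead_coeff ?q = coeff (?p * ?q) (Polynomial.degree ?p + Polynomial.degree ?q)"
      by (rule coeff_mult_degree_sum[symmetric])
    also have "\<dots> = 0"
      unfolding main_poly.hom_mult[symmetric] insert.prems(3) by simp
    finally have "lead_coeff ?p * lead_coeff ?q = 0" .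
    moreover have "vars (lead_coeff ?p) \<subseteq> S"
      using order_trans[OF vars_coeff_main_poly[of x p] Diff_mono[OF insert.prems(1) order_refl]] by auto
    moreover have "vars (lead_coeff ?q) \<subseteq> S"
      using order_trans[OF vars_coeff_main_poly[of x q] Diff_mono[OF insert.prems(2) order_refl]] by auto
    ultimately have "lead_coeff ?p = 0 \<or> lead_coeff ?q = 0"
      by (intro insert.IH)
    then show ?case
      by simp
  qed
  from this[of UNIV p q] show ?thesis
    using assms by simp
qed

lemma mpoly_mult_eq_0_iff [simp]:
  "p * q = 0 \<longleftrightarrow> p = 0 \<or> q = (0 :: ('m::finite, 'k::idom) mpoly)"
  using mpoly_no_zero_divisors by auto

lemma mpoly_mult_left_cancel:
  "c \<noteq> 0 \<Longrightarrow> c * a = c * b \<longleftrightarrow> a = (b :: ('m::finite, 'k::idom) mpoly)"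
  using mpoly_mult_eq_0_iff[of c "a - b"] by (auto simp: right_diff_distrib)

section \<open>Degree in one variable, and a size for induction on factors\<close>

abbreviation deg :: "'m \<Rightarrow> ('m::finite, 'k::comm_ring_1) mpoly \<Rightarrow> nat" where
  "deg x p \<equiv> Polynomial.degree (main_poly x p)"

abbreviation lead :: "'m \<Rightarrow> ('m::finite, 'k::comm_ring_1) mpoly \<Rightarrow> ('m, 'k) mpoly" where
  "lead x p \<equiv> lead_coeff (main_poly x p)"

lemma deg_eq_0_iff: "deg x p = 0 \<longleftrightarrow> x \<notin> vars p"
proof
  assume "deg x p = 0"
  then have "main_poly x p = [:coeff (main_poly x p) 0:]"
    by (metis degree_eq_zeroE coeff_pCons_0)
  then have "p = coeff (main_poly x p) 0"
    by (metis poly_main_poly poly_pCons poly_0 mult_zero_right add.right_neutral)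
  then show "x \<notin> vars p"
    using vars_coeff_main_poly[of x p 0] by auto
qed (simp add: main_poly_free)

lemma deg_mult:
  fixes p q :: "('m::finite, 'k::idom) mpoly"
  assumes "p \<noteq> 0" "q \<noteq> 0"
  shows "deg x (p * q) = deg x p + deg x q"
proof (rule antisym)
  have "coeff (main_poly x (p * q)) (deg x p + deg x q) \<noteq> 0"
    by (simp add: assms coeff_mult_degree_sum main_poly.hom_mult)
  then show "deg x p + deg x q \<le> deg x (p * q)"
    by (rule le_degree)
qed (simp add: degree_mult_le main_poly.hom_mult)

lemma lead_mult:
  fixes p q :: "('m::finite, 'k::idom) mpoly"
  assumes "p \<noteq> 0" "q \<noteq> 0"
  shows "lead x (p * q) = lead x p * lead x q"
  unfolding deg_mult[OF assms] unfolding main_poly.hom_mult by (rule coeff_mult_degree_sum)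

lemma vars_lead: "vars (lead x p) \<subseteq> vars p - {x}"
  by (rule vars_coeff_main_poly)

text \<open>Degrees add over a domain, so a factor of a nonzero polynomial has degree 0 in every
  variable that the product lacks.\<close>

lemma vars_dvd:
  fixes p q :: "('m::finite, 'k::idom) mpoly"
  assumes "p dvd q" "q \<noteq> 0"
  shows "vars p \<subseteq> vars q"
proof
  fix x assume x: "x \<in> vars p"
  obtain w where w: "q = p * w"
    using assms(1) by (elim dvdE)
  then have "deg x q = deg x p + deg x w"
    using assms(2) deg_mult[of p w x] by auto
  then show "x \<in> vars q"
    using x deg_eq_0_iff[of x p] deg_eq_0_iff[of x q] by simp
qed

text \<open>The sum of the separate degrees in the variables, not the total degree. Additivity on
  products then comes directly from \<open>deg_mult\<close>, and over a field size 0 means unit, so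
  proper factors are smaller.\<close>

definition mdeg :: "('m::finite, 'k::comm_ring_1) mpoly \<Rightarrow> nat" where
  "mdeg p = (\<Sum>x\<in>UNIV. deg x p)"

lemma mdeg_mult:
  "p \<noteq> 0 \<Longrightarrow> q \<noteq> 0 \<Longrightarrow> mdeg (p * q) = mdeg p + mdeg (q :: ('m::finite, 'k::idom) mpoly)"
  by (simp add: mdeg_def deg_mult sum.distrib)

lemma mdeg_eq_0_iff:
  fixes p :: "('m::finite, 'k::field) mpoly"
  assumes "p \<noteq> 0"
  shows "mdeg p = 0 \<longleftrightarrow> p dvd 1"
proof
  assume "mdeg p = 0"
  then have "vars p = {}"
    by (auto simp: mdeg_def deg_eq_0_iff)
  then obtain c where "p = Const c"
    using vars_empty_imp_Const[of p] by blast
  with assms show "p dvd 1"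
    by (simp add: Const_dvd_1)
next
  assume "p dvd 1"
  then have "vars p = {}"
    using vars_dvd[of p 1] by simp
  then show "mdeg p = 0"
    by (simp add: mdeg_def deg_eq_0_iff)
qed

lemma mpoly_unit_iff_Const: "(p :: ('m::finite, 'k::field) mpoly) dvd 1 \<longleftrightarrow> (\<exists>c. c \<noteq> 0 \<and> p = Const c)"
proof
  assume p: "p dvd 1"
  then obtain c where "p = Const c"
    using vars_dvd[of p 1] vars_empty_imp_Const[of p] by auto
  with p show "\<exists>c. c \<noteq> 0 \<and> p = Const c"
    by (intro exI[of _ c]) auto
qed (auto simp: Const_dvd_1)

lemma irreducible_factor_exists:
  fixes p :: "('m::finite, 'k::field) mpoly"
  assumes "p \<noteq> 0" "\<not> p dvd 1"
  shows "\<exists>q. irreducible q \<and> q dvd p"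
  using assms
proof (induction "mdeg p" arbitrary: p rule: less_induct)
  case less
  show ?case
  proof (cases "irreducible p")
    case False
    then obtain a b where ab: "p = a * b" "\<not> a dvd 1" "\<not> b dvd 1"
      using less.prems by (auto simp: irreducible_def)
    with less.prems have "mdeg a < mdeg p"
      using mdeg_eq_0_iff[of b] by (auto simp: mdeg_mult)
    then obtain q where "irreducible q" "q dvd a"
      using less.hyps[of a] less.prems ab by auto
    then show ?thesis
      using ab(1) by (meson dvd_mult2)
  qed auto
qed


subsection \<open>Irreducible polynomials are prime\<close>

text \<open>The top terms cancel. In degree 0 the difference would have degree 0 as well and nothing
  would drop, hence the demand for positive degree.\<close>

lemma deg_reduce_less:
  assumes "deg x f = deg x g" "lead x f = lead x g" "0 < deg x f"
  shows "deg x (f - g) < deg x f"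
proof -
  have "deg x (f - g) \<le> deg x f"
    using assms by (simp add: degree_diff_le)
  moreover have "coeff (main_poly x (f - g)) (deg x f) = 0"
    using assms by simp
  ultimately show ?thesis
    using assms(3) by (metis degree_0 le_neq_implies_less leading_coeff_0_iff)
qed

lemma
  fixes c :: "('m::finite, 'k::idom) mpoly"
  assumes "c \<noteq> 0" "x \<notin> vars c"
  shows deg_monomial: "deg x (c * Var x ^ n) = n"
    and lead_monomial_eq: "lead x (c * Var x ^ n) = c"
proof -
  have "main_poly x (c * Var x ^ n) = monom c n"
    using assms(2) by (simp add: main_poly.hom_mult main_poly.hom_power main_poly_Var main_poly_free monom_altdef)
  with assms(1) show "deg x (c * Var x ^ n) = n" "lead x (c * Var x ^ n) = c"
    by (simp_all add: degree_monom_eq)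
qed

text \<open>
  Gauss's lemma, as the induction step on the set of variables, without fraction fields or
  greatest common divisors: the role of the gcd of \<open>f\<close> and \<open>g\<close> is played by an element of the
  saturated ideal they generate that has minimal degree in \<open>x\<close> and, among these, minimal
  total size \<open>mdeg\<close>; the second condition makes it primitive.
\<close>

locale adjoin_variable =
  fixes x :: "'m::finite" and S :: "'m set" and coefficient_type :: "'k::field itself"
  assumes x_notin: "x \<notin> S"
    and prime_coeffs: "\<And>p g h :: ('m, 'k) mpoly.
      irreducible p \<Longrightarrow> vars p \<union> vars g \<union> vars h \<subseteq> S \<Longrightarrow> p dvd g * h \<Longrightarrow> p dvd g \<or> p dvd h"
begin

lemma vars_lead_subset: "vars f \<subseteq> insert x S \<Longrightarrow> vars (lead x f) \<subseteq> S"
  using vars_lead[of x f] by blast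

lemma x_notin_vars: "vars f \<subseteq> S \<Longrightarrow> x \<notin> vars f"
  using x_notin by blast

lemma vars_monomial_subset: "vars c \<subseteq> S \<Longrightarrow> vars (c * Var x ^ n :: ('m, 'k) mpoly) \<subseteq> insert x S"
proof (induction n)
  case (Suc n)
  then show ?case
    using vars_mult[of "c * Var x ^ n" "Var x"] vars_Var[of x] by (simp add: ac_simps) blast
qed auto

text \<open>Gauss's lemma for a prime among the coefficients: \<open>p\<close> does not involve
  \<open>x\<close>, so it divides every coefficient of \<open>g * h\<close>, hence
  \<open>lead x g * lead x h\<close>, hence one of the two leading coefficients. The matching
  leading term is subtracted, and the sum of the degrees drops.\<close>

lemma prime_over_adjoin:
  fixes p g h :: "('m, 'k) mpoly"
  assumes p: "irreducible p" "vars p \<subseteq> S"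
    and gh: "vars g \<subseteq> insert x S" "vars h \<subseteq> insert x S" "p dvd g * h"
  shows "p dvd g \<or> p dvd h"
  using gh
proof (induction "deg x g + deg x h" arbitrary: g h rule: less_induct)
  case less
  show ?case
  proof (cases "g = 0 \<or> h = 0")
    case False
    then have nz: "g \<noteq> 0" "h \<noteq> 0" by auto
    \<comment> \<open>Stated for arbitrary \<open>u\<close> and \<open>v\<close> with the same
      degree sum, so that it serves both the pair \<open>g\<close>, \<open>h\<close> and the pair
      \<open>h\<close>, \<open>g\<close>.\<close>
    have reduce: "p dvd u \<or> p dvd v"
      if uv: "u \<noteq> 0" "vars u \<subseteq> insert x S" "vars v \<subseteq> insert x S" "p dvd u * v"
        and deg: "deg x u + deg x v = deg x g + deg x h" and lead: "p dvd lead x u" for u v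
    proof -
      define t where "t = lead x u * Var x ^ deg x u"
      have vars_u: "vars (lead x u) \<subseteq> S" "x \<notin> vars (lead x u)"
        using vars_lead_subset uv(2) x_notin by blast+
      have u: "lead x u \<noteq> 0"
        using uv(1) by simp
      have t: "deg x t = deg x u" "lead x t = lead x u"
        unfolding t_def by (rule deg_monomial[OF u vars_u(2)], rule lead_monomial_eq[OF u vars_u(2)])
      have pt: "p dvd t"
        using lead by (simp add: t_def)
      show ?thesis
      proof (cases "deg x u = 0")
        case True
        then have "t = u"
          by (simp add: t_def deg_eq_0_iff main_poly_free)
        with pt show ?thesis by simp
      next
        case False
        have "p dvd (u - t) * v"
          using uv(4) pt by (simp add: left_diff_distrib)
        moreover have "vars (u - t) \<subseteq> insert x S"
          using vars_diff[of u t] uv(2) vars_monomial_subset[OF vars_u(1)] by (auto simp: t_def)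
        moreover have "deg x (u - t) < deg x u"
          using False t by (intro deg_reduce_less) auto
        ultimately have "p dvd u - t \<or> p dvd v"
          using less.hyps[of "u - t" v] uv(3) deg by simp
        then show ?thesis
          using pt dvd_add[of p "u - t" t] by auto
      qed
    qed
    have "p dvd lead x (g * h)"
    proof -
      obtain w where "g * h = p * w" using less.prems by (elim dvdE)
      then show ?thesis
        using p(2) by (simp add: main_poly_free x_notin_vars main_poly.hom_mult)
    qed
    then have "p dvd lead x g * lead x h"
      by (simp add: lead_mult[OF nz])
    then have "p dvd lead x g \<or> p dvd lead x h"
      using p less.prems by (intro prime_coeffs Un_least vars_lead_subset)
    then show ?thesis
      using reduce[of g h] reduce[of h g] nz less.prems by (auto simp: ac_simps)
  qed auto
qed

text \<open>Content 1 with respect to the variables \<open>S\<close>, expressed by irreducible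
  divisors so that no gcd of coefficients has to exist.\<close>

definition primitive :: "('m, 'k) mpoly \<Rightarrow> bool" where
  "primitive d \<longleftrightarrow> (\<forall>p. irreducible p \<longrightarrow> vars p \<subseteq> S \<longrightarrow> \<not> p dvd d)"

text \<open>A denominator \<open>c\<close> in the variables \<open>S\<close> can be removed. Each
  irreducible factor of \<open>c\<close> divides \<open>q * d\<close> and, \<open>d\<close> being
  primitive, divides \<open>q\<close> by \<open>prime_over_adjoin\<close>; cancelling it on both
  sides shrinks \<open>c\<close> until it is a unit.\<close>

lemma primitive_cancel:
  assumes "primitive d" "vars d \<subseteq> insert x S" "vars q \<subseteq> insert x S"
    and "c \<noteq> 0" "vars c \<subseteq> S" "c * f = q * d"
  shows "d dvd f"
  using assms(3-)
proof (induction "mdeg c" arbitrary: c q rule: less_induct)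
  case less
  show ?case
  proof (cases "c dvd 1")
    case True
    then obtain b where b: "c * b = 1"
      by (auto simp: dvd_def)
    have "f = (c * b) * f"
      by (simp only: b mult_1)
    also have "\<dots> = b * (c * f)"
      by (simp only: ac_simps)
    also have "\<dots> = (b * q) * d"
      by (simp only: less.prems(4) mult.assoc)
    finally show ?thesis
      by (metis dvd_triv_right)
  next
    case False
    then obtain p where p: "irreducible p" "p dvd c"
      using less.prems(2) irreducible_factor_exists[of c] by auto
    then obtain c' where c': "c = p * c'" by (elim dvdE)
    have nz: "p \<noteq> 0" "c' \<noteq> 0"
      using c' less.prems by auto
    have vars: "vars p \<subseteq> S" "vars c' \<subseteq> S"
      using less.prems(2,3) vars_dvd[of p c] vars_dvd[of c' c] c' by auto
    have "p dvd q * d"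
      unfolding less.prems(4)[symmetric] c' by (simp add: mult.assoc)
    then have "p dvd q \<or> p dvd d"
      by (rule prime_over_adjoin[OF p(1) vars(1) less.prems(1) assms(2)])
    then have "p dvd q"
      using assms(1) p(1) vars(1) by (auto simp: primitive_def)
    then obtain q' where q': "q = p * q'" by (elim dvdE)
    have "c' * f = q' * d"
      using less.prems(4) nz(1) unfolding c' q' mult.assoc by (simp add: mpoly_mult_left_cancel)
    moreover have "vars q' \<subseteq> insert x S"
      using less.prems(1) vars_dvd[of q' q] q' nz(1) by (cases "q = 0") auto
    moreover have "mdeg c' < mdeg c"
      using p(1) nz mdeg_eq_0_iff[OF nz(1)] by (auto simp: c' mdeg_mult irreducible_def)
    ultimately show ?thesis
      using less.hyps[of c' q'] nz vars by simp
  qed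
qed

text \<open>Division with remainder in \<open>x\<close> without fractions: each step multiplies by
  \<open>lead x d\<close>, and \<open>c\<close> collects these multipliers.\<close>

lemma pseudo_division:
  fixes d f :: "('m, 'k) mpoly"
  assumes d: "d \<noteq> 0" "vars d \<subseteq> insert x S" and f: "vars f \<subseteq> insert x S"
  shows "\<exists>c q s. c \<noteq> 0 \<and> vars c \<subseteq> S \<and> vars q \<subseteq> insert x S \<and> vars s \<subseteq> insert x S \<and>
    c * f = q * d + s \<and> (s = 0 \<or> deg x s < deg x d)"
  using f
proof (induction "deg x f" arbitrary: f rule: less_induct)
  case less
  consider "f = 0 \<or> deg x f < deg x d" | "f \<noteq> 0" "deg x d \<le> deg x f" "deg x f = 0" | "f \<noteq> 0" "deg x d \<le> deg x f" "0 < deg x f"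
    by linarith
  then show ?case
  proof cases
    case 1
    with less.prems show ?thesis
      by (intro exI[of _ 1] exI[of _ 0] exI[of _ f]) auto
  next
    \<comment> \<open>Both degrees are 0, so \<open>deg_reduce_less\<close> cannot act; but then
      \<open>d\<close> itself lies in the variables \<open>S\<close> and serves as the
      multiplier.\<close>
    case 2
    then have "vars d \<subseteq> S"
      using d by (auto simp: deg_eq_0_iff)
    with d less.prems show ?thesis
      by (intro exI[of _ d] exI[of _ f] exI[of _ 0]) (auto simp: ac_simps)
  next
    case 3
    define n where "n = deg x f - deg x d"
    define t where "t = lead x f * Var x ^ n"
    define g where "g = lead x d * f - t * d"
    have lead: "lead x d \<noteq> 0" "vars (lead x d) \<subseteq> S" "lead x f \<noteq> 0" "vars (lead x f) \<subseteq> S"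
      using d 3 less.prems vars_lead_subset by auto
    have t_deg: "deg x t = n" and t_lead: "lead x t = lead x f"
      unfolding t_def using lead(3) x_notin_vars[OF lead(4)] by (rule deg_monomial, rule lead_monomial_eq)
    have t: "t \<noteq> 0"
      using t_lead lead(3) by auto
    have main_lead: "main_poly x (lead x d) = [:lead x d:]"
      using lead(2) by (simp add: main_poly_free x_notin_vars)
    have deg_eq: "deg x (lead x d * f) = deg x f" "deg x (t * d) = deg x f"
      using 3(2) by (simp_all add: deg_mult[OF lead(1) 3(1)] deg_mult[OF t d(1)] main_lead t_deg n_def)
    have "lead x (t * d) = lead x f * lead x d"
      by (simp only: lead_mult[OF t d(1)] t_lead)
    moreover have "lead x (lead x d * f) = lead x d * lead x f"
      by (simp only: lead_mult[OF lead(1) 3(1)] main_lead degree_pCons_0 coeff_pCons_0)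
    ultimately have "lead x (lead x d * f) = lead x (t * d)"
      by (simp only: mult.commute)
    then have deg_g: "deg x g < deg x f"
      using deg_reduce_less[of x "lead x d * f" "t * d"] 3(3) by (simp only: g_def deg_eq)
    have vars_t: "vars t \<subseteq> insert x S"
      using lead by (simp add: t_def vars_monomial_subset)
    have vars_g: "vars g \<subseteq> insert x S"
      unfolding g_def using vars_t d(2) lead(2) less.prems
      by (intro order_trans[OF vars_diff] Un_least order_trans[OF vars_mult]) auto
    obtain c q s where c: "c \<noteq> 0" "vars c \<subseteq> S" "vars q \<subseteq> insert x S" "vars s \<subseteq> insert x S"
      "c * g = q * d + s" "s = 0 \<or> deg x s < deg x d"
      using less.hyps[OF deg_g vars_g] by auto
    have "(c * lead x d) * f = (q + c * t) * d + s"
      using c(5) by (simp add: g_def algebra_simps)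
    moreover have "vars (c * lead x d) \<subseteq> S"
      using c(2) lead(2) by (intro order_trans[OF vars_mult] Un_least)
    moreover have "vars (q + c * t) \<subseteq> insert x S"
      using c vars_t by (intro order_trans[OF vars_add] Un_least order_trans[OF vars_mult]) auto
    ultimately show ?thesis
      using c lead(1) by (intro exI[of _ "c * lead x d"] exI[of _ "q + c * t"] exI[of _ s]) auto
  qed
qed

text \<open>A Bezout argument. The minimal \<open>d\<close> divides both \<open>f\<close> and
  \<open>g\<close>, and irreducibility of \<open>f = d * w\<close> leaves two cases. If
  \<open>w\<close> is a unit, \<open>f\<close> divides \<open>d\<close> and hence \<open>g\<close>.
  If \<open>d\<close> is a unit, \<open>c * d = u * f + v * g\<close> times \<open>h\<close> shows
  that \<open>f\<close> divides \<open>(c * d) * h\<close>, and the factor \<open>c * d\<close>,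
  free of \<open>x\<close>, is removed by \<open>primitive_cancel\<close>.\<close>

lemma prime_adjoin:
  fixes f g h :: "('m, 'k) mpoly"
  assumes f: "irreducible f" and vars: "vars f \<union> vars g \<union> vars h \<subseteq> insert x S"
    and dvd: "f dvd g * h"
  shows "f dvd g \<or> f dvd h"
proof (cases "vars f \<subseteq> S")
  case True
  with assms show ?thesis
    using prime_over_adjoin by auto
next
  case False
  have "f \<noteq> 0"
    using f by auto
  \<comment> \<open>The ideal generated by \<open>f\<close> and \<open>g\<close> after inverting the nonzero polynomials in the variables \<open>S\<close>.\<close>
  define J where "J = {d. vars d \<subseteq> insert x S \<and> (\<exists>c u v. c \<noteq> 0 \<and> vars c \<subseteq> S \<and> c * d = u * f + v * g)}"
  have J_I: "u * f + v * g \<in> J" if "vars (u * f + v * g) \<subseteq> insert x S" for u v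
  proof -
    have "1 * (u * f + v * g) = u * f + v * g" "vars (1 :: ('m, 'k) mpoly) \<subseteq> S"
      by simp_all
    with that show ?thesis
      unfolding J_def using one_neq_zero by blast
  qed
  have fJ: "f \<in> J" and gJ: "g \<in> J"
    using J_I[of 1 0] J_I[of 0 1] vars by simp_all
  obtain d where d: "d \<in> J" "d \<noteq> 0"
    and least: "\<And>e. e \<in> J \<Longrightarrow> e \<noteq> 0 \<Longrightarrow> deg x d < deg x e \<or> (deg x d = deg x e \<and> mdeg d \<le> mdeg e)"
  proof -
    define m where "m e = (deg x e, mdeg e)" for e :: "('m, 'k) mpoly"
    obtain z where "z \<in> m ` (J - {0})" and min: "\<And>y. (y, z) \<in> less_than <*lex*> less_than \<Longrightarrow> y \<notin> m ` (J - {0})"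
      using wfE_min[OF wf_lex_prod[OF wf_less_than wf_less_than], of "m f" "m ` (J - {0})"] fJ \<open>f \<noteq> 0\<close> by blast
    then obtain d where d: "d \<in> J" "d \<noteq> 0" "z = m d" by auto
    have "deg x d < deg x e \<or> (deg x d = deg x e \<and> mdeg d \<le> mdeg e)" if "e \<in> J" "e \<noteq> 0" for e
      using min[of "m e"] that d(3) unfolding m_def by force
    with d that show thesis by blast
  qed
  obtain c u v where c: "c \<noteq> 0" "vars c \<subseteq> S" "c * d = u * f + v * g" and vars_d: "vars d \<subseteq> insert x S"
    using d(1) by (auto simp: J_def)
  \<comment> \<open>Dividing \<open>d\<close> by an irreducible \<open>p\<close> in the variables
    \<open>S\<close> would stay in \<open>J\<close>, with \<open>p\<close> moved into the
    multiplier, keep the degree in \<open>x\<close> and lower \<open>mdeg\<close>.\<close>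
  have prim: "primitive d"
    unfolding primitive_def
  proof (intro allI impI notI)
    fix p assume p: "irreducible p" "vars p \<subseteq> S" "p dvd d"
    then obtain d' where d': "d = p * d'" by (elim dvdE)
    have nz: "p \<noteq> 0" "d' \<noteq> 0"
      using d' d(2) by auto
    have "vars d' \<subseteq> insert x S"
      using d' d(2) vars_dvd[of d' d] vars_d by auto
    moreover have "(c * p) * d' = u * f + v * g"
      using c(3) by (simp add: d' mult.assoc)
    moreover have "vars (c * p) \<subseteq> S"
      using c(2) p(2) by (intro order_trans[OF vars_mult] Un_least)
    moreover have "c * p \<noteq> 0"
      using c(1) nz(1) by simp
    ultimately have "d' \<in> J"
      unfolding J_def by blast
    moreover have "deg x d = deg x d'"
      using deg_mult[OF nz, of x] p(2) by (simp add: d' main_poly_free x_notin_vars)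
    moreover have "mdeg d' < mdeg d"
      using p(1) nz mdeg_eq_0_iff[OF nz(1)] by (auto simp: d' mdeg_mult irreducible_def)
    ultimately show False
      using least[of d'] nz by auto
  qed
  \<comment> \<open>The remainder of \<open>e\<close> on pseudo-division by \<open>d\<close> lies in
    \<open>J\<close> again, so minimality makes it 0, and primitivity of \<open>d\<close> removes
    the multiplier.\<close>
  have d_dvd: "d dvd e" if "e \<in> J" for e
  proof -
    obtain c' u' v' where c': "c' \<noteq> 0" "vars c' \<subseteq> S" "c' * e = u' * f + v' * g" and vars_e: "vars e \<subseteq> insert x S"
      using \<open>e \<in> J\<close> by (auto simp: J_def)
    obtain b q s where b: "b \<noteq> 0" "vars b \<subseteq> S" "vars q \<subseteq> insert x S" "vars s \<subseteq> insert x S"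
      "b * e = q * d + s" "s = 0 \<or> deg x s < deg x d"
      using pseudo_division[OF d(2) vars_d vars_e] by blast
    have s: "s = b * e - q * d"
      by (simp add: b(5))
    have "c' * c * s = c * b * (c' * e) - c' * q * (c * d)"
      unfolding s by (simp add: algebra_simps)
    also have "\<dots> = (c * b * u' - c' * q * u) * f + (c * b * v' - c' * q * v) * g"
      unfolding c(3) c'(3) by (simp add: algebra_simps)
    finally have "c' * c * s = \<dots>" .
    moreover have "vars (c' * c) \<subseteq> S" "c' * c \<noteq> 0"
      using c c' by (auto intro!: order_trans[OF vars_mult])
    ultimately have "s \<in> J"
      using b(4) unfolding J_def by blast
    then have "s = 0"
      using least[of s] b(6) by fastforce
    then show ?thesis
      using primitive_cancel[OF prim vars_d b(3,1,2)] b(5) by simp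
  qed
  obtain w where w: "f = d * w"
    using d_dvd[OF fJ] by (elim dvdE)
  with f have "d dvd 1 \<or> w dvd 1"
    by (auto simp: irreducible_def)
  then show ?thesis
  proof
    assume "w dvd 1"
    then have "f dvd d"
      using w mult_dvd_mono[of d d w 1] by simp
    then show ?thesis
      using d_dvd[OF gJ] dvd_trans by blast
  next
    assume "d dvd 1"
    show ?thesis
    proof (cases "h = 0")
      case False
      have "f dvd (c * d) * h"
        unfolding c(3) using dvd by (simp add: distrib_right mult.assoc)
      then obtain y where y: "(c * d) * h = y * f"
        by (metis dvdE mult.commute)
      have vars_cd: "vars (c * d) \<subseteq> S"
        using c(2) vars_dvd[OF \<open>d dvd 1\<close>] by (intro order_trans[OF vars_mult]) auto
      moreover have "vars y \<subseteq> insert x S"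
      proof -
        have "y dvd (c * d) * h" "(c * d) * h \<noteq> 0"
          using y c(1) d(2) False by auto
        then have "vars y \<subseteq> vars (c * d * h)"
          by (rule vars_dvd)
        then show ?thesis
          using vars_mult[of "c * d" h] vars_cd vars by blast
      qed
      \<comment> \<open>An irreducible divisor of \<open>f\<close> in the variables \<open>S\<close>
        would be \<open>f\<close> up to a unit, but \<open>f\<close> involves
        \<open>x\<close>.\<close>
      moreover have "primitive f"
        unfolding primitive_def
      proof (intro allI impI notI)
        fix p assume p: "irreducible p" "vars p \<subseteq> S" "p dvd f"
        then obtain t where t: "f = p * t" by (elim dvdE)
        with f p(1) have "t dvd 1"
          by (auto simp: irreducible_def)
        then have "vars f \<subseteq> S"
          using vars_mult[of p t] vars_dvd[of t 1] p(2) by (auto simp: t)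
        with False \<open>\<not> vars f \<subseteq> S\<close> show False by simp
      qed
      ultimately show ?thesis
        using primitive_cancel[of f y "c * d" h] y vars c(1) d(2) by auto
    qed auto
  qed
qed

end

text \<open>The variables are adjoined one at a time. With none present, an irreducible polynomial
  would be a nonzero constant, that is, a unit.\<close>

theorem mpoly_irreducible_dvd_mult:
  fixes p g h :: "('m::finite, 'k::field) mpoly"
  assumes "irreducible p" "p dvd g * h"
  shows "p dvd g \<or> p dvd h"
proof -
  have "p dvd g \<or> p dvd h"
    if "finite S" "irreducible p" "vars p \<union> vars g \<union> vars h \<subseteq> S" "p dvd g * h"
    for S and p g h :: "('m, 'k) mpoly"
    using that
  proof (induction S arbitrary: p g h)
    case empty
    then have "vars p = {}" "p \<noteq> 0" "\<not> p dvd 1"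
      by (auto simp: irreducible_def)
    then show ?case
      using vars_empty_imp_Const[of p] by (auto simp: Const_dvd_1)
  next
    case (insert x S)
    interpret adjoin_variable x S "TYPE('k)"
      by standard (use insert in blast)+
    show ?case
      using insert.prems by (intro prime_adjoin)
  qed
  from this[of UNIV p g h] show ?thesis
    using assms by simp
qed

subsection \<open>Unique factorization into monic irreducible polynomials\<close>

lemma lookup_Const_mult: "Poly_Mapping.lookup (Const c * p) a = c * Poly_Mapping.lookup (p :: ('m, 'k::comm_ring_1) mpoly) a"
proof -
  have "Const c * p = Poly_Mapping.map ((*) c) p"
    by (simp add: Const_def mult_map_scale_conv_mult)
  then show ?thesis
    by (simp add: Poly_Mapping.map.rep_eq when_def)
qed

lemma irreducible_unit_mult:
  fixes u q :: "'a::comm_semiring_1"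
  assumes "u dvd 1" "irreducible q"
  shows "irreducible (u * q)"
proof (rule irreducibleI)
  obtain v where v: "u * v = 1"
    using assms(1) by (auto simp: dvd_def)
  have q: "v * (u * q) = q"
    using v by (metis mult.assoc mult.commute mult_1)
  show "u * q \<noteq> 0"
    using q assms(2) by auto
  show "\<not> u * q dvd 1"
    using assms(2) dvd_mult_right[of u q 1] by (auto simp: irreducible_def)
  fix a b assume "u * q = a * b"
  then have "q = (v * a) * b"
    using q by (simp add: mult.assoc)
  then have "v * a dvd 1 \<or> b dvd 1"
    using assms(2) by (auto dest: irreducibleD)
  then show "a dvd 1 \<or> b dvd 1"
    by (auto dest: dvd_mult_right)
qed

section \<open>Leading terms for a monomial order\<close>

locale monomial_ordering =
  fixes r :: "('m::finite monomial \<times> 'm monomial) set"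
  assumes monomial_order: "monomial_order r"
begin

lemma ordering_refl: "(a, a) \<in> r"
  and ordering_trans: "(a, b) \<in> r \<Longrightarrow> (b, c) \<in> r \<Longrightarrow> (a, c) \<in> r"
  and ordering_antisym: "(a, b) \<in> r \<Longrightarrow> (b, a) \<in> r \<Longrightarrow> a = b"
  and ordering_zero: "(0, a) \<in> r"
  and ordering_add: "(a, b) \<in> r \<Longrightarrow> (a + c, b + c) \<in> r"
  using monomial_order
  unfolding monomial_order_def linear_order_on_def partial_order_on_def preorder_on_def total_on_def
  by (auto simp: refl_on_def dest: transD antisymD)

lemma ordering_total: "(a, b) \<in> r \<or> (b, a) \<in> r"
  using monomial_order ordering_refl
  unfolding monomial_order_def linear_order_on_def total_on_def by (cases "a = b") auto

abbreviation lm :: "('m, 'k::zero) mpoly \<Rightarrow> 'm monomial" where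
  "lm \<equiv> lead_monomial r"

abbreviation lc :: "('m, 'k::zero) mpoly \<Rightarrow> 'k" where
  "lc p \<equiv> Poly_Mapping.lookup p (lm p)"

lemma lead_monomial_eqI:
  assumes "a \<in> Poly_Mapping.keys p" "\<And>b. b \<in> Poly_Mapping.keys p \<Longrightarrow> (b, a) \<in> r"
  shows "lm p = a"
  unfolding lead_monomial_def using assms ordering_antisym by (intro the_equality) auto

lemma lead_monomial:
  assumes "p \<noteq> 0"
  shows lead_monomial_in_keys: "lm p \<in> Poly_Mapping.keys p"
    and keys_le_lead_monomial: "b \<in> Poly_Mapping.keys p \<Longrightarrow> (b, lm p) \<in> r"
proof -
  have "\<exists>a\<in>A. \<forall>b\<in>A. (b, a) \<in> r" if "finite A" "A \<noteq> {}" for A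
    using that
  proof (induction A rule: finite_ne_induct)
    case (insert x A)
    then obtain a where "a \<in> A" "\<forall>b\<in>A. (b, a) \<in> r" by blast
    then show ?case
      using ordering_total[of a x] ordering_refl ordering_trans by blast
  qed (use ordering_refl in auto)
  moreover have "Poly_Mapping.keys p \<noteq> {}"
    using assms by simp
  ultimately obtain a where "a \<in> Poly_Mapping.keys p" "\<forall>b\<in>Poly_Mapping.keys p. (b, a) \<in> r"
    using finite_keys by blast
  then show "lm p \<in> Poly_Mapping.keys p" "b \<in> Poly_Mapping.keys p \<Longrightarrow> (b, lm p) \<in> r"
    using lead_monomial_eqI[of a p] by auto
qed

lemma ordering_add_mono: "(a, b) \<in> r \<Longrightarrow> (c, d) \<in> r \<Longrightarrow> (a + c, b + d) \<in> r"
  using ordering_trans[OF ordering_add[of a b c]] ordering_add[of c d b] by (simp add: add.commute)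

text \<open>Strict monotonicity of addition in disguise: it makes \<open>lm p + lm q\<close>
  attainable only by the two leading monomials.\<close>

lemma ordering_add_eqD:
  assumes "(a, b) \<in> r" "(c, d) \<in> r" "a + c = b + d"
  shows "a = b" "c = d"
proof -
  have "(b + c, b + d) \<in> r"
    using ordering_add[OF assms(2), of b] by (simp add: add.commute)
  moreover have "(b + d, b + c) \<in> r"
    using ordering_add[OF assms(1), of c] by (simp add: assms(3))
  ultimately have "b + c = b + d"
    by (rule ordering_antisym)
  with assms(3) show "a = b"
    by simp
  with assms(3) show "c = d"
    by simp
qed

text \<open>With \<open>s\<close> and \<open>t\<close> the leading terms,
  \<open>p * q = s * t + (p - s) * q + s * (q - t)\<close>, and neither of the last two products has
  a term at \<open>lm p + lm q\<close>.\<close>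

lemma lookup_mult_lead_monomials:
  fixes p q :: "('m, 'k::idom) mpoly"
  assumes "p \<noteq> 0" "q \<noteq> 0"
  shows "Poly_Mapping.lookup (p * q) (lm p + lm q) = lc p * lc q"
proof -
  define s where "s = Poly_Mapping.single (lm p) (lc p)"
  define t where "t = Poly_Mapping.single (lm q) (lc q)"
  have "lm p + lm q \<notin> Poly_Mapping.keys ((p - s) * q)"
  proof
    assume "lm p + lm q \<in> Poly_Mapping.keys ((p - s) * q)"
    then obtain a b where "lm p + lm q = a + b" and a: "a \<in> Poly_Mapping.keys (p - s)" and "b \<in> Poly_Mapping.keys q"
      using keys_mult[of "p - s" q] by blast
    moreover have "a \<in> Poly_Mapping.keys p" "a \<noteq> lm p"
      using a by (auto simp: in_keys_iff lookup_minus s_def lookup_single when_def split: if_splits)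
    ultimately show False
      using ordering_add_eqD(1)[of a "lm p" b "lm q"] keys_le_lead_monomial[OF assms(1)] keys_le_lead_monomial[OF assms(2)]
      by simp
  qed
  moreover have "lm p + lm q \<notin> Poly_Mapping.keys (s * (q - t))"
  proof
    assume "lm p + lm q \<in> Poly_Mapping.keys (s * (q - t))"
    then obtain b where "lm p + lm q = lm p + b" and b: "b \<in> Poly_Mapping.keys (q - t)"
      using keys_mult[of s "q - t"] by (auto simp: s_def split: if_splits)
    then show False
      by (auto simp: in_keys_iff lookup_minus t_def lookup_single)
  qed
  moreover have "p * q = s * t + (p - s) * q + s * (q - t)"
    by (simp add: algebra_simps)
  ultimately show ?thesis
    by (simp only: lookup_add in_keys_iff) (simp add: s_def t_def mult_single)
qed

lemma
  fixes p q :: "('m, 'k::idom) mpoly"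
  assumes "p \<noteq> 0" "q \<noteq> 0"
  shows lead_monomial_mult: "lm (p * q) = lm p + lm q"
    and lead_coefficient_mult: "lc (p * q) = lc p * lc q"
proof -
  show lm: "lm (p * q) = lm p + lm q"
  proof (rule lead_monomial_eqI)
    show "lm p + lm q \<in> Poly_Mapping.keys (p * q)"
      using lead_monomial_in_keys[OF assms(1)] lead_monomial_in_keys[OF assms(2)]
      by (simp add: in_keys_iff lookup_mult_lead_monomials assms)
  next
    fix c assume "c \<in> Poly_Mapping.keys (p * q)"
    then obtain a b where "c = a + b" "a \<in> Poly_Mapping.keys p" "b \<in> Poly_Mapping.keys q"
      using keys_mult[of p q] by blast
    then show "(c, lm p + lm q) \<in> r"
      using ordering_add_mono[OF keys_le_lead_monomial[OF assms(1)] keys_le_lead_monomial[OF assms(2)]] by simp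
  qed
  show "lc (p * q) = lc p * lc q"
    by (simp add: lm lookup_mult_lead_monomials assms)
qed

lemma lead_coefficient_neq_0: "p \<noteq> 0 \<Longrightarrow> lc p \<noteq> 0"
  using lead_monomial_in_keys by (simp add: in_keys_iff)

lemma lead_monomial_Const: "lm (Const c) = 0" if "c \<noteq> 0"
  by (rule lead_monomial_eqI) (use that in \<open>auto simp: Const_def ordering_refl\<close>)

lemma monic_Const_iff: "monic r (Const c) \<longleftrightarrow> c = (1 :: 'k::comm_ring_1)"
  by (cases "c = 0") (simp_all add: monic_def lead_monomial_Const, simp_all add: Const_def)

lemma monic_1: "monic r (1 :: ('m, 'k::comm_ring_1) mpoly)"
  using monic_Const_iff[of 1] by simp

lemma monic_mult:
  "monic r p \<Longrightarrow> monic r q \<Longrightarrow> monic r (p * q :: ('m, 'k::idom) mpoly)"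
  by (simp add: monic_def lead_coefficient_mult)

lemma monic_mult_cancel:
  "monic r (p * q) \<Longrightarrow> monic r p \<Longrightarrow> monic r (q :: ('m, 'k::idom) mpoly)"
  by (auto simp: monic_def lead_coefficient_mult)

lemma monic_prod_mset:
  "(\<And>q. q \<in># M \<Longrightarrow> monic r q) \<Longrightarrow> monic r (prod_mset M :: ('m, 'k::idom) mpoly)"
  by (induction M) (auto simp: monic_1 monic_mult)

lemma monic_normalize:
  fixes p :: "('m, 'k::field) mpoly"
  assumes "p \<noteq> 0"
  shows "monic r (Const (inverse (lc p)) * p)"
proof -
  have nz: "inverse (lc p) \<noteq> 0"
    using assms lead_coefficient_neq_0 by simp
  then have "lm (Const (inverse (lc p)) * p) = lm p"
    using assms by (simp add: lead_monomial_mult lead_monomial_Const)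
  then show ?thesis
    using assms nz by (simp add: monic_def lookup_Const_mult lead_coefficient_neq_0)
qed

section \<open>Existence and uniqueness of monic factorizations\<close>

lemma monic_unit: "monic r p \<Longrightarrow> p dvd 1 \<Longrightarrow> p = (1 :: ('m, 'k::field) mpoly)"
  by (auto simp: mpoly_unit_iff_Const monic_Const_iff)

text \<open>The cofactor is a unit, hence a constant, and as a quotient of monic polynomials it is
  1.\<close>

lemma Irr_dvd_imp_eq:
  assumes "p \<in> Irr r" "q \<in> Irr r" "p dvd q"
  shows "p = (q :: ('m, 'k::field) mpoly)"
proof -
  obtain w where w: "q = p * w"
    using assms(3) by (elim dvdE)
  then have "w dvd 1"
    using assms(1,2) by (auto simp: Irr_def irreducible_def)
  moreover have "monic r w"
    using assms(1,2) monic_mult_cancel by (auto simp: Irr_def w)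
  ultimately show ?thesis
    using w monic_unit[of w] by simp
qed

lemma Irr_dvd_prod_mset:
  fixes p :: "('m, 'k::field) mpoly"
  assumes p: "p \<in> Irr r" and "set_mset M \<subseteq> Irr r" "p dvd prod_mset M"
  shows "p \<in># M"
  using assms(2,3)
proof (induction M)
  case empty
  with p show ?case by (simp add: Irr_def irreducible_def)
next
  case (add x M)
  then show ?case
    using mpoly_irreducible_dvd_mult[of p x "prod_mset M"] Irr_dvd_imp_eq[of p x] p by (auto simp: Irr_def)
qed

lemma prod_mset_Irr_eq_iff:
  fixes M N :: "('m, 'k::field) mpoly multiset"
  assumes "set_mset M \<subseteq> Irr r" "set_mset N \<subseteq> Irr r"
  shows "prod_mset M = prod_mset N \<longleftrightarrow> M = N"
proof
  assume "prod_mset M = prod_mset N"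
  with assms show "M = N"
  proof (induction M arbitrary: N)
    case empty
    then have "\<not> x \<in># N" for x
      using dvd_prod_mset[of x N] by (auto simp: Irr_def irreducible_def)
    then show ?case
      by (auto intro: multiset_nonemptyE)
  next
    case (add x M)
    then have x: "x \<in> Irr r" "x \<noteq> 0"
      by (auto simp: Irr_def irreducible_def)
    moreover have "x dvd prod_mset N"
      using add.prems(3) by (metis dvd_triv_left prod_mset.add_mset)
    ultimately have "x \<in># N"
      using Irr_dvd_prod_mset add.prems(2) by auto
    then obtain N' where N': "N = add_mset x N'"
      by (metis insert_DiffM)
    then have "prod_mset M = prod_mset N'"
      using add.prems(3) x(2) by (simp add: mpoly_mult_left_cancel)
    then show ?case
      using add.IH[of N'] add.prems(1,2) N' by simp
  qed
qed simp

lemma monic_factorization_exists: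
  fixes p :: "('m, 'k::field) mpoly"
  assumes "monic r p"
  shows "\<exists>M. set_mset M \<subseteq> Irr r \<and> p = prod_mset M"
  using assms
proof (induction "mdeg p" arbitrary: p rule: less_induct)
  case less
  show ?case
  proof (cases "p dvd 1")
    case True
    with less.prems show ?thesis
      using monic_unit by (intro exI[of _ "{#}"]) simp
  next
    case False
    have "p \<noteq> 0"
      using less.prems by (simp add: monic_def)
    with False obtain q where q: "irreducible q" "q dvd p"
      using irreducible_factor_exists[of p] by auto
    \<comment> \<open>An irreducible factor may fail to be monic; the constant that normalizes it is
      a unit, so \<open>q'\<close> still divides \<open>p\<close>.\<close>
    define q' where "q' = Const (inverse (lc q)) * q"
    have "q \<noteq> 0"
      using q(1) by auto
    have unit: "(Const (inverse (lc q)) :: ('m, 'k) mpoly) dvd 1"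
      using \<open>q \<noteq> 0\<close> lead_coefficient_neq_0 by (intro Const_dvd_1) simp
    then have q': "q' \<in> Irr r"
      using q(1) \<open>q \<noteq> 0\<close> monic_normalize irreducible_unit_mult[OF unit] unfolding Irr_def q'_def by auto
    have "q' dvd p"
      using q(2) unit mult_dvd_mono[of "Const (inverse (lc q))" 1 q p] by (simp add: q'_def)
    then obtain w where w: "p = q' * w" by (elim dvdE)
    have nz: "q' \<noteq> 0" "w \<noteq> 0"
      using \<open>p \<noteq> 0\<close> w by auto
    have "\<not> q' dvd 1"
      using q' by (auto simp: Irr_def irreducible_def)
    then have "mdeg w < mdeg p"
      using nz mdeg_eq_0_iff[of q'] by (simp add: w mdeg_mult)
    moreover have "monic r w"
      using less.prems q' monic_mult_cancel[of q' w] by (simp add: w Irr_def)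
    ultimately obtain M where "set_mset M \<subseteq> Irr r" "w = prod_mset M"
      using less.hyps by auto
    then show ?thesis
      using q' w by (intro exI[of _ "add_mset q' M"]) simp
  qed
qed

end

subsection \<open>Translations\<close>

interpretation shift: ring_morphism "shift c :: ('m::finite, 'k::comm_ring_1) mpoly \<Rightarrow> _"
  unfolding shift_def subst_eq_evaluate by (rule Const.ring_morphism_evaluate)

declare shift.hom_mult [simp del]

lemma shift_Const: "shift c (Const a) = Const a"
  by (simp add: shift_def subst_eq_evaluate Const.evaluate_Const)

lemma shift_Var: "shift c (Var j) = Var j + Const (c $ j)"
  by (simp add: shift_def subst_eq_evaluate Const.evaluate_Var)

lemma shift_shift: "shift c (shift d p) = shift (c + d) p"
proof -
  have "shift c (shift d p) = evaluate (\<lambda>a. shift c (Const a)) (\<lambda>j. shift c (Var j + Const (d $ j))) p"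
    unfolding shift_def[of d] subst_eq_evaluate by (rule evaluate_comp) (rule shift.ring_morphism_axioms)
  also have "\<dots> = shift (c + d) p"
    unfolding shift_def[of "c + d"] subst_eq_evaluate
    by (rule arg_cong2[where f = "\<lambda>h f. evaluate h f p"]) (auto simp: shift_Const shift_Var add.assoc)
  finally show ?thesis .
qed

lemma shift_0: "shift 0 p = p"
  by (simp add: shift_def subst_eq_evaluate evaluate_Const_Var)

lemma shift_inverse [simp]: "shift (- c) (shift c p) = p" "shift c (shift (- c) p) = p"
  by (simp_all add: shift_shift shift_0)

lemma inj_shift: "inj (shift c)"
  by (metis injI shift_inverse(1))

text \<open>The sign flips because a multiplicity of the image at \<open>v\<close> is read off at
  the preimage of \<open>v\<close>.\<close>

lemma count_image_shift: "count (image_mset (shift c) M) v = count M (shift (- c) v)"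
proof (induction M)
  case (add x M)
  have "shift c x = v \<longleftrightarrow> x = shift (- c) v"
    by auto
  with add show ?case
    by simp
qed simp

lemma funpow_shift: "shift c ^^ n = shift (of_nat n *s c)"
proof (induction n)
  case 0
  show ?case by (simp add: fun_eq_iff shift_0)
next
  case (Suc n)
  then show ?case
    by (simp add: fun_eq_iff shift_shift vector_sadd_rdistrib)
qed

lemma inv_shift: "inv (shift c) = shift (- c)"
  by (rule inv_equality) simp_all

lemma irreducible_shift:
  assumes "irreducible p"
  shows "irreducible (shift c p)"
proof (rule irreducibleI)
  have unit: "shift d a dvd 1 \<longleftrightarrow> a dvd 1" for d and a :: "('a, 'b) mpoly"
    using shift.hom_dvd[of a 1 d] shift.hom_dvd[of "shift d a" 1 "- d"] by auto
  show "shift c p \<noteq> 0"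
    using assms inj_onD[OF inj_shift, of c p 0] by auto
  show "\<not> shift c p dvd 1"
    using assms by (simp add: unit irreducible_def)
  fix a b assume "shift c p = a * b"
  then have "p = shift (- c) a * shift (- c) b"
    by (metis shift.hom_mult shift_inverse(1))
  then show "a dvd 1 \<or> b dvd 1"
    using irreducibleD[OF assms] unit by blast
qed

section \<open>Translations preserve leading terms\<close>

context monomial_ordering
begin

lemma monic_Var_plus_Const:
  shows "monic r (Var j + Const c :: ('m, 'k::comm_ring_1) mpoly)"
    and "lm (Var j + Const c :: ('m, 'k) mpoly) = Poly_Mapping.single j 1"
proof -
  let ?p = "Var j + Const c :: ('m, 'k) mpoly"
  have single_eq_0: "0 \<noteq> Poly_Mapping.single j (1 :: nat)"
    by (metis lookup_single_eq lookup_zero zero_neq_one)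
  have lookup: "Poly_Mapping.lookup ?p (Poly_Mapping.single j 1) = 1"
    using single_eq_0 by (simp add: Var_def Const_def lookup_add lookup_single)
  have keys: "Poly_Mapping.keys ?p \<subseteq> {Poly_Mapping.single j 1, 0}"
    using keys_add[of "Var j :: ('m, 'k) mpoly" "Const c"] keys_Const[of c] by (auto simp: Var_def)
  show lm: "lm ?p = Poly_Mapping.single j 1"
    using keys by (intro lead_monomial_eqI) (auto simp: in_keys_iff lookup ordering_zero ordering_refl simp del: One_nat_def)
  show "monic r ?p"
    using lookup by (auto simp: monic_def lm)
qed

lemma monic_power:
  assumes "monic r (p :: ('m, 'k::idom) mpoly)"
  shows "monic r (p ^ n)"
  using assms by (induction n) (auto simp: monic_1 monic_mult)

lemma lead_monomial_power:
  assumes "monic r (p :: ('m, 'k::idom) mpoly)" "lm p = Poly_Mapping.single j 1"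
  shows "lm (p ^ n) = Poly_Mapping.single j n"
proof (induction n)
  case 0
  show ?case
    using lead_monomial_Const[of "1 :: 'k"] by simp
next
  case (Suc n)
  have "p \<noteq> 0" "p ^ n \<noteq> 0"
    using assms(1) monic_power[OF assms(1), of n] by (auto simp: monic_def)
  with Suc show ?case
    by (simp add: lead_monomial_mult assms(2) flip: single_add)
qed

lemma monic_lead_monomial_prod:
  assumes "finite A" "\<And>x. x \<in> A \<Longrightarrow> monic r (f x :: ('m, 'k::idom) mpoly)"
  shows "monic r (prod f A) \<and> lm (prod f A) = (\<Sum>x\<in>A. lm (f x))"
  using assms
proof (induction A)
  case empty
  then show ?case
    using lead_monomial_Const[of "1 :: 'k"] by (simp add: monic_1)
next
  case (insert x A)
  then have "monic r (f x)" "monic r (prod f A)"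
    by auto
  moreover from this have "f x \<noteq> 0" "prod f A \<noteq> 0"
    by (auto simp: monic_def)
  ultimately show ?case
    using insert by (simp add: monic_mult lead_monomial_mult)
qed

text \<open>A translation turns the monomial \<open>a\<close> into the product \<open>m a\<close> of
  powers of u_j + c_j, which is monic with leading monomial \<open>a\<close>. So every monomial of
  the translated polynomial is at most \<open>lm p\<close>, and only \<open>m (lm p)\<close> reaches
  it.\<close>

lemma lead_monomial_shift:
  fixes p :: "('m, 'k::idom) mpoly"
  assumes "p \<noteq> 0"
  shows "lm (shift c p) = lm p" and "lc (shift c p) = lc p"
proof -
  define m :: "'m monomial \<Rightarrow> ('m, 'k) mpoly"
    where "m a = (\<Prod>j\<in>UNIV. (Var j + Const (c $ j)) ^ Poly_Mapping.lookup a j)" for a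
  have m: "monic r (m a)" "lm (m a) = a" for a
  proof -
    have "monic r (m a) \<and> lm (m a) = (\<Sum>j\<in>UNIV. Poly_Mapping.single j (Poly_Mapping.lookup a j))"
      using monic_lead_monomial_prod[of UNIV "\<lambda>j. (Var j + Const (c $ j)) ^ Poly_Mapping.lookup a j"]
      by (simp add: m_def monic_power monic_Var_plus_Const lead_monomial_power)
    then show "monic r (m a)" "lm (m a) = a"
      by (simp_all add: monomial_eq_sum_single)
  qed
  have le: "(b, a) \<in> r" if "Poly_Mapping.lookup (m a) b \<noteq> 0" for a b
    using keys_le_lead_monomial[of "m a" b] m[of a] that by (auto simp: in_keys_iff monic_def)
  have lookup: "Poly_Mapping.lookup (shift c p) b =
    (\<Sum>a\<in>Poly_Mapping.keys p. Poly_Mapping.lookup p a * Poly_Mapping.lookup (m a) b)" for b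
    by (simp add: shift_def subst_def m_def lookup_sum lookup_Const_mult)
  have "Poly_Mapping.lookup (shift c p) (lm p) =
    (\<Sum>a\<in>{lm p}. Poly_Mapping.lookup p a * Poly_Mapping.lookup (m a) (lm p))"
    unfolding lookup
  proof (rule sum.mono_neutral_right)
    show "\<forall>a\<in>Poly_Mapping.keys p - {lm p}. Poly_Mapping.lookup p a * Poly_Mapping.lookup (m a) (lm p) = 0"
      using le ordering_antisym keys_le_lead_monomial[OF assms] by fastforce
  qed (use lead_monomial_in_keys[OF assms] in auto)
  also have "\<dots> = lc p"
    using m[of "lm p"] by (simp add: monic_def)
  finally have lookup_lm: "Poly_Mapping.lookup (shift c p) (lm p) = lc p" .
  show "lm (shift c p) = lm p"
  proof (rule lead_monomial_eqI)
    show "lm p \<in> Poly_Mapping.keys (shift c p)"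
      using assms by (simp add: in_keys_iff lookup_lm lead_coefficient_neq_0)
  next
    fix b assume "b \<in> Poly_Mapping.keys (shift c p)"
    then have "(\<Sum>a\<in>Poly_Mapping.keys p. Poly_Mapping.lookup p a * Poly_Mapping.lookup (m a) b) \<noteq> 0"
      by (simp add: in_keys_iff lookup)
    then obtain a where "a \<in> Poly_Mapping.keys p" "Poly_Mapping.lookup (m a) b \<noteq> 0"
      by (metis (no_types, lifting) mult_zero_right sum.neutral)
    then show "(b, lm p) \<in> r"
      using le ordering_trans keys_le_lead_monomial[OF assms] by blast
  qed
  then show "lc (shift c p) = lc p"
    by (simp add: lookup_lm)
qed

lemma shift_Irr: "p \<in> Irr r \<Longrightarrow> shift c p \<in> Irr r"
  using lead_monomial_shift[of p c] irreducible_shift[of p c] by (auto simp: Irr_def monic_def irreducible_def)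

end


subsection \<open>Orbits\<close>

text \<open>Where the characteristic enters: \<open>1 / 2\<close> is 0 in characteristic 2, and two
  half steps would no longer make a full one.\<close>

lemma column_eq_double_half:
  assumes "CHAR('k::field) \<noteq> 2"
  shows "column i \<alpha> = (1 / 2) *s column i \<alpha> + (1 / 2) *s column i (\<alpha> :: 'k ^ 2 ^ 'm)"
proof -
  have "(2 :: 'k) \<noteq> 0"
  proof
    assume "(2 :: 'k) = 0"
    then have "CHAR('k) dvd 2"
      using of_nat_eq_0_iff_char_dvd[where 'a = 'k, of 2] by simp
    then show False
      using assms CHAR_not_1'[where 'a = 'k] prime_nat_iff[of 2] two_is_prime_nat by auto
  qed
  then show ?thesis
    by (simp flip: vector_sadd_rdistrib)
qed

lemma sigma_pow_eq_shift: "sigma_pow \<alpha> i k = shift (- (of_int k *s column i \<alpha>))"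
proof (cases "k \<ge> 0")
  case True
  then show ?thesis
    by (simp add: sigma_pow_def sigma_def funpow_shift)
next
  case False
  then show ?thesis
    by (simp add: sigma_pow_def sigma_def inv_shift funpow_shift)
qed

text \<open>\<open>sigma\<close> translates by minus the column, so a translation by the column
  lowers one exponent by 1.\<close>

lemma shift_column_orbit:
  assumes "p \<in> orbit \<alpha> q"
  shows "shift (column i \<alpha>) p \<in> orbit \<alpha> q"
proof -
  obtain k l where p: "p = sigma_pow \<alpha> 1 k (sigma_pow \<alpha> 2 l q)"
    using assms by (auto simp: orbit_def)
  have "shift (column 1 \<alpha>) p = sigma_pow \<alpha> 1 (k - 1) (sigma_pow \<alpha> 2 l q)"
    "shift (column 2 \<alpha>) p = sigma_pow \<alpha> 1 k (sigma_pow \<alpha> 2 (l - 1) q)"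
    unfolding p sigma_pow_eq_shift shift_shift by (simp_all add: vector_ssub_ldistrib vector_sadd_rdistrib algebra_simps)
  then show ?thesis
    using exhaust_2[of i] by (auto simp: orbit_def)
qed


lemma shift_uminus_column_orbit:
  assumes "p \<in> orbit \<alpha> q"
  shows "shift (- column i \<alpha>) p \<in> orbit \<alpha> q"
proof -
  obtain k l where p: "p = sigma_pow \<alpha> 1 k (sigma_pow \<alpha> 2 l q)"
    using assms by (auto simp: orbit_def)
  have "shift (- column 1 \<alpha>) p = sigma_pow \<alpha> 1 (k + 1) (sigma_pow \<alpha> 2 l q)"
    "shift (- column 2 \<alpha>) p = sigma_pow \<alpha> 1 k (sigma_pow \<alpha> 2 (l + 1) q)"
    unfolding p sigma_pow_eq_shift shift_shift by (simp_all add: vector_sadd_rdistrib algebra_simps)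
  then show ?thesis
    using exhaust_2[of i] by (auto simp: orbit_def)
qed

text \<open>The multiset equation compares multiplicities at every polynomial, the vertex condition
  only at \<open>vertices\<close>. Elsewhere all four multiplicities vanish, so nothing is
  lost.\<close>

lemma six_vertex_iff_multiset:
  fixes \<alpha> :: "'k::field ^ 2 ^ 'm::finite" and M\<^sub>1 M\<^sub>2 :: "('m, 'k) mpoly multiset"
  assumes char: "CHAR('k) \<noteq> 2"
    and M: "set_mset M\<^sub>1 \<subseteq> edges \<alpha> (orbit \<alpha> q) 1" "set_mset M\<^sub>2 \<subseteq> edges \<alpha> (orbit \<alpha> q) 2"
  shows "(\<forall>v\<in>vertices \<alpha> (orbit \<alpha> q).
      count M\<^sub>1 (sigma_half \<alpha> 2 v) + count M\<^sub>2 (sigma_half \<alpha> 1 v) =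
      count M\<^sub>1 (sigma_neg_half \<alpha> 2 v) + count M\<^sub>2 (sigma_neg_half \<alpha> 1 v)) \<longleftrightarrow>
    image_mset (sigma_half \<alpha> 2) M\<^sub>1 + image_mset (sigma_half \<alpha> 1) M\<^sub>2 =
    image_mset (sigma_neg_half \<alpha> 2) M\<^sub>1 + image_mset (sigma_neg_half \<alpha> 1) M\<^sub>2"
proof -
  define a where "a = (1 / 2) *s column 1 \<alpha>"
  define b where "b = (1 / 2) *s column 2 \<alpha>"
  have col: "column 1 \<alpha> = a + a" "column 2 \<alpha> = b + b"
    unfolding a_def b_def by (rule column_eq_double_half[OF char])+
  have sigma: "sigma_half \<alpha> 1 = shift (- a)" "sigma_half \<alpha> 2 = shift (- b)"
    "sigma_neg_half \<alpha> 1 = shift a" "sigma_neg_half \<alpha> 2 = shift b"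
    by (simp_all add: sigma_half_def sigma_neg_half_def a_def b_def)
  let ?O = "orbit \<alpha> q" and ?V = "vertices \<alpha> (orbit \<alpha> q)"
  have V: "v \<in> ?V \<longleftrightarrow> (\<exists>x\<in>?O. v = shift (- a - b) x)" for v
    by (auto simp: vertices_def sigma shift_shift)
  have vertexI: "v \<in> ?V" if "shift (a + b) v \<in> ?O" for v
    using that unfolding V by (intro bexI[of _ "shift (a + b) v"]) (simp_all add: shift_shift shift_0)
  have M\<^sub>1: "shift a e \<in> ?O" if "e \<in># M\<^sub>1" for e
    using that M(1) by (auto simp: edges_def sigma)
  have M\<^sub>2: "shift b e \<in> ?O" if "e \<in># M\<^sub>2" for e
    using that M(2) by (auto simp: edges_def sigma)
  \<comment> \<open>If \<open>shift b v\<close> or \<open>shift a v\<close> is an edge in its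
    multiset, \<open>shift (a + b) v\<close> is in the orbit at once. With the opposite signs one
    more translation by a whole column is required, under which the orbit is stable.\<close>
  have vertex: "v \<in> ?V"
    if "shift (- b) v \<in># M\<^sub>1 \<or> shift (- a) v \<in># M\<^sub>2 \<or> shift b v \<in># M\<^sub>1 \<or> shift a v \<in># M\<^sub>2" for v
    using that
  proof (elim disjE)
    assume "shift (- b) v \<in># M\<^sub>1"
    then show ?thesis
      using shift_column_orbit[OF M\<^sub>1, of "shift (- b) v" 2]
      by (intro vertexI) (simp add: col shift_shift algebra_simps)
  next
    assume "shift (- a) v \<in># M\<^sub>2"
    then show ?thesis
      using shift_column_orbit[OF M\<^sub>2, of "shift (- a) v" 1]
      by (intro vertexI) (simp add: col shift_shift algebra_simps)
  next
    assume "shift b v \<in># M\<^sub>1"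
    then show ?thesis
      using M\<^sub>1 by (intro vertexI) (force simp: shift_shift)
  next
    assume "shift a v \<in># M\<^sub>2"
    then show ?thesis
      using M\<^sub>2 by (intro vertexI) (force simp: shift_shift add.commute)
  qed
  have "(count M\<^sub>1 (shift b v) + count M\<^sub>2 (shift a v) = count M\<^sub>1 (shift (- b) v) + count M\<^sub>2 (shift (- a) v))"
    if "v \<notin> ?V" for v
  proof -
    have "shift b v \<notin># M\<^sub>1" "shift a v \<notin># M\<^sub>2" "shift (- b) v \<notin># M\<^sub>1" "shift (- a) v \<notin># M\<^sub>2"
      using that vertex[of v] by blast+
    then show ?thesis
      by (simp add: not_in_iff)
  qed
  \<comment> \<open>By \<open>count_image_shift\<close> the multiset on the left, built with
    \<open>sigma_half\<close>, has the counts taken at \<open>sigma_neg_half\<close>; the two sides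
    of the condition change places.\<close>
  then show ?thesis
    by (simp add: sigma multiset_eq_iff count_image_shift) metis
qed

lemma solution_iff_multiset:
  fixes p :: "('m::finite, 'k::field) mpoly ^ 2"
  assumes "monomial_order r" and Irr: "\<And>i. set_mset (M i) \<subseteq> Irr r"
    and p: "\<And>i. p $ i = prod_mset (M i)"
  shows "solution \<alpha> p \<longleftrightarrow>
    image_mset (sigma_half \<alpha> 2) (M 1) + image_mset (sigma_half \<alpha> 1) (M 2) =
    image_mset (sigma_neg_half \<alpha> 2) (M 1) + image_mset (sigma_neg_half \<alpha> 1) (M 2)"
proof -
  interpret monomial_ordering r
    by standard fact
  have "set_mset (image_mset (shift c) (M i)) \<subseteq> Irr r" for c i
    using Irr shift_Irr by auto
  then show ?thesis
    unfolding solution_def p sigma_half_def sigma_neg_half_def shift.hom_prod_mset prod_mset.union[symmetric]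
    by (subst prod_mset_Irr_eq_iff) auto
qed

section \<open>Configurations as multisets of edges\<close>

lemma config_poly_eq_prod_mset:
  assumes "set_mset M \<subseteq> edges \<alpha> \<O> i" "\<And>e. e \<in> edges \<alpha> \<O> i \<Longrightarrow> L i e = count M e"
  shows "config_poly \<alpha> \<O> L i = prod_mset M"
proof -
  have "{e \<in> edges \<alpha> \<O> i. L i e \<noteq> 0} = set_mset M"
    using assms by auto
  then show ?thesis
    unfolding config_poly_def prod_mset_multiplicity using assms by (auto intro!: prod.cong)
qed

text \<open>The values of \<open>L\<close> off the edges are replaced by 0: for a configuration they
  are \<open>undefined\<close>, hence arbitrary, while a multiset has finite support.\<close>

lemma finite_config_multiset:
  assumes "finite_config \<alpha> \<O> L"
  obtains M where "\<And>i. set_mset (M i) \<subseteq> edges \<alpha> \<O> i"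
    "\<And>i e. e \<in> edges \<alpha> \<O> i \<Longrightarrow> L i e = count (M i) e"
proof -
  define M where "M i = Abs_multiset (\<lambda>e. if e \<in> edges \<alpha> \<O> i then L i e else 0)" for i
  have "finite {e. 0 < (if e \<in> edges \<alpha> \<O> i then L i e else 0)}" for i
    using assms by (auto simp: finite_config_def elim: rev_finite_subset)
  then have count: "count (M i) e = (if e \<in> edges \<alpha> \<O> i then L i e else 0)" for i e
    unfolding M_def by (subst count_Abs_multiset) simp_all
  have "set_mset (M i) \<subseteq> edges \<alpha> \<O> i" for i
    by (auto simp: count simp flip: count_greater_zero_iff split: if_splits)
  then show thesis
    by (rule that) (simp add: count)
qed

lemma edges_subset_Irr:
  assumes "monomial_order r" "q \<in> Irr r"
  shows "edges \<alpha> (orbit \<alpha> q) i \<subseteq> Irr r"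
proof -
  interpret monomial_ordering r
    by standard fact
  show ?thesis
    using assms(2) by (auto simp: edges_def orbit_def sigma_half_def sigma_pow_eq_shift shift_Irr)
qed

text \<open>Keeps the vertex condition inside the domains of the configuration, where its values are
  multiplicities. If \<open>v\<close> comes from \<open>x\<close> in the orbit,
  \<open>sigma_half\<close> completes one of the half steps to a full step of \<open>x\<close>, and
  \<open>sigma_neg_half\<close> undoes it; one half step remains either way.\<close>

lemma edges_at_vertex:
  fixes \<alpha> :: "'k::field ^ 2 ^ 'm::finite"
  assumes "CHAR('k) \<noteq> 2" "v \<in> vertices \<alpha> (orbit \<alpha> q)"
  shows "sigma_half \<alpha> 2 v \<in> edges \<alpha> (orbit \<alpha> q) 1" "sigma_half \<alpha> 1 v \<in> edges \<alpha> (orbit \<alpha> q) 2"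
    "sigma_neg_half \<alpha> 2 v \<in> edges \<alpha> (orbit \<alpha> q) 1" "sigma_neg_half \<alpha> 1 v \<in> edges \<alpha> (orbit \<alpha> q) 2"
proof -
  define a where "a = (1 / 2) *s column 1 \<alpha>"
  define b where "b = (1 / 2) *s column 2 \<alpha>"
  have col: "column 1 \<alpha> = a + a" "column 2 \<alpha> = b + b"
    unfolding a_def b_def by (rule column_eq_double_half[OF assms(1)])+
  have sigma: "sigma_half \<alpha> 1 = shift (- a)" "sigma_half \<alpha> 2 = shift (- b)"
    "sigma_neg_half \<alpha> 1 = shift a" "sigma_neg_half \<alpha> 2 = shift b"
    by (simp_all add: sigma_half_def sigma_neg_half_def a_def b_def)
  obtain x where x: "x \<in> orbit \<alpha> q" and v: "v = shift (- a) (shift (- b) x)"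
    using assms(2) by (auto simp: vertices_def sigma)
  have "sigma_half \<alpha> 2 v = shift (- a) (shift (- column 2 \<alpha>) x)"
    "sigma_half \<alpha> 1 v = shift (- b) (shift (- column 1 \<alpha>) x)"
    unfolding sigma v col shift_shift by (simp_all add: add_ac del: add_uminus_conv_diff)
  moreover have "sigma_neg_half \<alpha> 2 v = shift (- a) x" "sigma_neg_half \<alpha> 1 v = shift (- b) x"
    by (simp_all add: sigma v col shift_shift algebra_simps)
  ultimately show "sigma_half \<alpha> 2 v \<in> edges \<alpha> (orbit \<alpha> q) 1" "sigma_half \<alpha> 1 v \<in> edges \<alpha> (orbit \<alpha> q) 2"
    "sigma_neg_half \<alpha> 2 v \<in> edges \<alpha> (orbit \<alpha> q) 1" "sigma_neg_half \<alpha> 1 v \<in> edges \<alpha> (orbit \<alpha> q) 2"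
    using x shift_uminus_column_orbit[OF x] by (auto simp: edges_def sigma intro!: imageI)
qed

theorem theorem5p2:
  fixes r :: "('m::finite monomial \<times> 'm monomial) set"
    and \<alpha> :: "'k::field ^ 2 ^ 'm"
    and \<O> :: "('m, 'k) mpoly set"
  assumes "CHAR('k) \<noteq> 2"
    and "monomial_order r"
    and "\<O> \<in> Irr_orbits r \<alpha>"
  shows
    "(\<forall>L. six_vertex_config \<alpha> \<O> L \<and> finite_config \<alpha> \<O> L \<longrightarrow>
        (\<forall>p :: ('m, 'k) mpoly ^ 2. (\<forall>i. p $ i = config_poly \<alpha> \<O> L i) \<longrightarrow>
           (\<forall>i. monic r (p $ i)) \<and> orbital r \<alpha> \<O> p \<and> solution \<alpha> p))
     \<and>
     (\<forall>p :: ('m, 'k) mpoly ^ 2.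
        (\<forall>i. monic r (p $ i)) \<and> orbital r \<alpha> \<O> p \<and> solution \<alpha> p \<longrightarrow>
        (\<exists>!L. six_vertex_config \<alpha> \<O> L \<and> finite_config \<alpha> \<O> L \<and>
              (\<forall>i. p $ i = config_poly \<alpha> \<O> L i)))"
proof -
  interpret monomial_ordering r
    by standard fact
  obtain q where q: "q \<in> Irr r" and \<O>: "\<O> = orbit \<alpha> q"
    using assms(3) by (auto simp: Irr_orbits_def)
  have edges_Irr: "edges \<alpha> \<O> i \<subseteq> Irr r" for i
    unfolding \<O> using assms(2) q by (rule edges_subset_Irr)
  have half_edges: "sigma_half \<alpha> 2 v \<in> edges \<alpha> \<O> 1" "sigma_half \<alpha> 1 v \<in> edges \<alpha> \<O> 2"
    "sigma_neg_half \<alpha> 2 v \<in> edges \<alpha> \<O> 1" "sigma_neg_half \<alpha> 1 v \<in> edges \<alpha> \<O> 2"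
    if "v \<in> vertices \<alpha> \<O>" for v
    using that unfolding \<O> by (rule edges_at_vertex[OF assms(1)])+
  \<comment> \<open>Serves both directions: \<open>M\<close> links the configuration
    \<open>L\<close> with the pair \<open>p\<close>, and the vertex condition and the equation
    become the same statement about \<open>M\<close>.\<close>
  have config_iff: "six_vertex_config \<alpha> \<O> L \<longleftrightarrow> solution \<alpha> p"
    if "\<And>i. set_mset (M i) \<subseteq> edges \<alpha> \<O> i" "\<And>i e. e \<in> edges \<alpha> \<O> i \<Longrightarrow> L i e = count (M i) e"
      "\<And>i. L i \<in> extensional (edges \<alpha> \<O> i)" "\<And>i. p $ i = prod_mset (M i)"
    for L M and p :: "('m, 'k) mpoly ^ 2"
  proof -
    have "six_vertex_config \<alpha> \<O> L \<longleftrightarrow> (\<forall>v\<in>vertices \<alpha> \<O>.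
      count (M 1) (sigma_half \<alpha> 2 v) + count (M 2) (sigma_half \<alpha> 1 v) =
      count (M 1) (sigma_neg_half \<alpha> 2 v) + count (M 2) (sigma_neg_half \<alpha> 1 v))"
      by (simp add: six_vertex_config_def that(2,3) half_edges)
    also have "\<dots> \<longleftrightarrow> solution \<alpha> p"
    proof (subst solution_iff_multiset[OF assms(2) _ that(4)])
      show "set_mset (M i) \<subseteq> Irr r" for i
        using that(1) edges_Irr by blast
    qed (use that(1) in \<open>simp add: \<O> six_vertex_iff_multiset[OF assms(1)]\<close>)
    finally show ?thesis .
  qed
  show ?thesis
  proof (intro conjI allI impI)
    fix L and p :: "('m, 'k) mpoly ^ 2" and i
    assume L: "six_vertex_config \<alpha> \<O> L \<and> finite_config \<alpha> \<O> L"
      and p: "\<forall>i. p $ i = config_poly \<alpha> \<O> L i"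
    obtain M where M: "\<And>i. set_mset (M i) \<subseteq> edges \<alpha> \<O> i"
      "\<And>i e. e \<in> edges \<alpha> \<O> i \<Longrightarrow> L i e = count (M i) e"
      using L finite_config_multiset by blast
    have pM: "p $ i = prod_mset (M i)" for i
      using p config_poly_eq_prod_mset[of "M i" \<alpha> \<O> i L] M by simp
    have M_Irr: "set_mset (M i) \<subseteq> Irr r" for i
      using M(1) edges_Irr by blast
    show "monic r (p $ i)"
      unfolding pM using M_Irr by (intro monic_prod_mset) (auto simp: Irr_def)
    show "orbital r \<alpha> \<O> p"
      unfolding orbital_def pM using Irr_dvd_prod_mset M_Irr M(1) by blast
    show "solution \<alpha> p"
      using L config_iff[OF M _ pM] by (simp add: six_vertex_config_def)
  next
    fix p :: "('m, 'k) mpoly ^ 2"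
    assume p: "(\<forall>i. monic r (p $ i)) \<and> orbital r \<alpha> \<O> p \<and> solution \<alpha> p"
    then have "\<forall>i. \<exists>M. set_mset M \<subseteq> Irr r \<and> p $ i = prod_mset M"
      using monic_factorization_exists by blast
    then obtain M where M_Irr: "\<And>i. set_mset (M i) \<subseteq> Irr r" and pM: "\<And>i. p $ i = prod_mset (M i)"
      by metis
    \<comment> \<open>Every element of \<open>M i\<close> is a monic irreducible divisor of
      \<open>p $ i\<close>, which is what \<open>orbital\<close> constrains.\<close>
    have M: "set_mset (M i) \<subseteq> edges \<alpha> \<O> i" for i
      using p M_Irr[of i] dvd_prod_mset unfolding orbital_def pM by blast
    \<comment> \<open>\<open>restrict\<close> fixes the values off the edges, so that uniqueness can
      hold as an equation of functions.\<close>
    define L where "L i = restrict (count (M i)) (edges \<alpha> \<O> i)" for i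
    have count_L: "L i e = count (M i) e" if "e \<in> edges \<alpha> \<O> i" for i e
      using that by (simp add: L_def)
    have ext_L: "L i \<in> extensional (edges \<alpha> \<O> i)" for i
      by (simp add: L_def)
    show "\<exists>!L. six_vertex_config \<alpha> \<O> L \<and> finite_config \<alpha> \<O> L \<and> (\<forall>i. p $ i = config_poly \<alpha> \<O> L i)"
    proof (intro ex1I[of _ L] conjI allI)
      show "six_vertex_config \<alpha> \<O> L"
        using p config_iff[OF M count_L ext_L pM] by simp
      show "finite_config \<alpha> \<O> L"
        unfolding finite_config_def by (auto intro: finite_subset[OF _ finite_set_mset[of "M _"]] simp: count_L)
      show "p $ i = config_poly \<alpha> \<O> L i" for i
        using pM config_poly_eq_prod_mset[of "M i" \<alpha> \<O> i L] M count_L by simp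
    next
      fix L' assume L': "six_vertex_config \<alpha> \<O> L' \<and> finite_config \<alpha> \<O> L' \<and> (\<forall>i. p $ i = config_poly \<alpha> \<O> L' i)"
      obtain M' where M': "\<And>i. set_mset (M' i) \<subseteq> edges \<alpha> \<O> i"
        "\<And>i e. e \<in> edges \<alpha> \<O> i \<Longrightarrow> L' i e = count (M' i) e"
        using L' finite_config_multiset by blast
      \<comment> \<open>A second configuration has a multiset of its own with the same product;
        unique factorization identifies the multisets, and extensionality then identifies the
        functions.\<close>
      have "prod_mset (M' i) = prod_mset (M i)" for i
        using L' pM config_poly_eq_prod_mset[of "M' i" \<alpha> \<O> i L'] M' by simp
      moreover have "set_mset (M' i) \<subseteq> Irr r" for i
        using M'(1) edges_Irr by blast
      ultimately have "M' i = M i" for i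
        using prod_mset_Irr_eq_iff M_Irr by blast
      moreover have "L' i \<in> extensional (edges \<alpha> \<O> i)" for i
        using L' by (simp add: six_vertex_config_def)
      ultimately have "L' i = L i" for i
        using M'(2) count_L ext_L by (intro extensionalityI[of _ "edges \<alpha> \<O> i"]) simp_all
      then show "L' = L"
        by (rule ext)
    qed
  qed
qed

end
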